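(* Let $\mathcal H$ be a regular unitarily invariant space. Then: (i) for every ideal $\mathfrak a\subset\mathcal M(\mathcal H)$, $\operatorname{supp}(\mathfrak a)\cap\mathbb B_d=\mathcal Z_{\mathbb B_d}(\mathfrak a)$ and $\operatorname{supp}(\mathfrak a)\subset\overline{\mathbb B}_d$; (ii) if $\mathfrak a\subset\mathfrak b$ are ideals of $\mathcal M(\mathcal H)$, then $\operatorname{supp}(\mathfrak b)\subset\operatorname{supp}(\mathfrak a)$; (iii) for ideals $\mathfrak a,\mathfrak b\subset\mathcal M(\mathcal H)$, $\operatorname{supp}(\mathfrak a\cap\mathfrak b)=\operatorname{supp}(\mathfrak a)\cup\operatorname{supp}(\mathfrak b)=\operatorname{supp}(\mathfrak a\cdot\mathfrak b)$ and $\operatorname{supp}(\mathfrak a+\mathfrak b)\subset\operatorname{supp}(\mathfrak a)\cap\operatorname{supp}(\mathfrak b)$; (iv) for weak-$*$ closed ideals $\mathfrak a,\mathfrak b\subset\mathcal M(\mathcal H)$, $\operatorname{supp}(\mathfrak a\cdot\mathfrak b)=\operatorname{supp}(\overline{\mathfrak a\cdot\mathfrak b}^{w*})$.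
   Context: A regular unitarily invariant space: a reproducing kernel Hilbert space $\mathcal H$ of holomorphic functions on $\mathbb B_d$ with kernel $K(z,w)=1+\sum_{n\ge1}a_n\langle z,w\rangle^n$, $a_n>0$, $a_n/a_{n+1}\to1$, having the complete Nevanlinna–Pick property. $\mathcal M(\mathcal H)$ is its multiplier algebra (weak-$*$ closed in $B(\mathcal H)$). $\operatorname{supp}(\mathfrak a)=\{z\in\mathbb C^d: 1\notin\mathfrak a+\sum_{j=1}^d(x_j-z_j)\mathcal M(\mathcal H)\}$. $\mathcal Z_{\mathbb B_d}(\mathfrak a)=\{z\in\mathbb B_d:f(z)=0\ \forall f\in\mathfrak a\}$. $\mathfrak a\cdot\mathfrak b$ is the (algebraic) product ideal, and $\overline{\,\cdot\,}^{w*}$ denotes weak-$*$ closure. *)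

theory Defs
  imports "HOL-Analysis.Analysis"
begin

definition cinner :: "complex^'d \<Rightarrow> complex^'d \<Rightarrow> complex" where
  "cinner z w = (\<Sum>j\<in>UNIV. z$j * cnj (w$j))"

definition bball :: "(complex^'d) set" where
  "bball = {z. (\<Sum>j\<in>UNIV. (cmod (z$j))^2) < 1}"

definition cbball :: "(complex^'d) set" where
  "cbball = {z. (\<Sum>j\<in>UNIV. (cmod (z$j))^2) \<le> 1}"

definition regular_coeffs :: "(nat \<Rightarrow> real) \<Rightarrow> bool" where
  "regular_coeffs a \<longleftrightarrow> a 0 = 1 \<and> (\<forall>n\<ge>1. 0 < a n) \<and> (\<lambda>n. a n / a (Suc n)) \<longlonglongrightarrow> 1"

definition ukernel :: "(nat \<Rightarrow> real) \<Rightarrow> complex^'d \<Rightarrow> complex^'d \<Rightarrow> complex" where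
  "ukernel a z w = (\<Sum>n. complex_of_real (a n) * (cinner z w) ^ n)"

definition psd_on :: "'a set \<Rightarrow> ('a \<Rightarrow> 'a \<Rightarrow> complex) \<Rightarrow> bool" where
  "psd_on S L \<longleftrightarrow> (\<forall>n (z::nat \<Rightarrow> 'a) (c::nat \<Rightarrow> complex). (\<forall>i<n. z i \<in> S) \<longrightarrow>
     (let q = (\<Sum>i<n. \<Sum>j<n. c i * cnj (c j) * L (z i) (z j)) in Im q = 0 \<and> 0 \<le> Re q))"

text \<open>The reproducing kernel Hilbert space H(K) on the ball (Aronszajn's description:
  f in H(K) with norm at most c iff c^2 K - f(z) conj(f(w)) is positive semidefinite).
  Functions are normalised to vanish off the ball.\<close>
definition rkhs :: "(complex^'d \<Rightarrow> complex^'d \<Rightarrow> complex) \<Rightarrow> (complex^'d \<Rightarrow> complex) set" where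
  "rkhs K = {f. (\<forall>z. z \<notin> bball \<longrightarrow> f z = 0) \<and>
     (\<exists>c\<ge>0. psd_on bball (\<lambda>z w. complex_of_real (c^2) * K z w - f z * cnj (f w)))}"

definition hnorm :: "(complex^'d \<Rightarrow> complex^'d \<Rightarrow> complex) \<Rightarrow> (complex^'d \<Rightarrow> complex) \<Rightarrow> real" where
  "hnorm K f = Inf {c. 0 \<le> c \<and> psd_on bball (\<lambda>z w. complex_of_real (c^2) * K z w - f z * cnj (f w))}"

text \<open>Inner product of H(K) (linear in the first argument), via polarisation.\<close>
definition hinner :: "(complex^'d \<Rightarrow> complex^'d \<Rightarrow> complex) \<Rightarrow> (complex^'d \<Rightarrow> complex) \<Rightarrow> (complex^'d \<Rightarrow> complex) \<Rightarrow> complex" where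
  "hinner K f g = (\<Sum>k<(4::nat). \<i>^k * complex_of_real ((hnorm K (\<lambda>z. f z + \<i>^k * g z))^2)) / 4"

definition mult_alg :: "(complex^'d \<Rightarrow> complex^'d \<Rightarrow> complex) \<Rightarrow> (complex^'d \<Rightarrow> complex) set" where
  "mult_alg K = {\<phi>. (\<forall>z. z \<notin> bball \<longrightarrow> \<phi> z = 0) \<and> (\<forall>f\<in>rkhs K. (\<lambda>z. \<phi> z * f z) \<in> rkhs K)}"

text \<open>Complete Nevanlinna-Pick property (matrix-valued Pick interpolation).\<close>
definition cnp :: "(complex^'d \<Rightarrow> complex^'d \<Rightarrow> complex) \<Rightarrow> bool" where
  "cnp K \<longleftrightarrow> (\<forall>(r::nat) (s::nat) (n::nat) (zs::nat \<Rightarrow> complex^'d) (W::nat \<Rightarrow> nat \<Rightarrow> nat \<Rightarrow> complex).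
     0 < r \<and> 0 < s \<and> (\<forall>i<n. zs i \<in> bball) \<and>
     (\<forall>c::nat \<Rightarrow> nat \<Rightarrow> complex.
        let q = (\<Sum>i<n. \<Sum>j<n. \<Sum>p<r. \<Sum>p'<r. cnj (c i p) * c j p' *
                  ((if p = p' then 1 else 0) - (\<Sum>t<s. W i p t * cnj (W j p' t))) * K (zs i) (zs j))
        in Im q = 0 \<and> 0 \<le> Re q)
     \<longrightarrow> (\<exists>\<Phi>::nat \<Rightarrow> nat \<Rightarrow> (complex^'d \<Rightarrow> complex).
           (\<forall>p<r. \<forall>t<s. \<Phi> p t \<in> mult_alg K) \<and>
           (\<forall>F::nat \<Rightarrow> (complex^'d \<Rightarrow> complex). (\<forall>t<s. F t \<in> rkhs K) \<longrightarrow>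
              (\<Sum>p<r. (hnorm K (\<lambda>z. \<Sum>t<s. \<Phi> p t z * F t z))^2) \<le> (\<Sum>t<s. (hnorm K (F t))^2)) \<and>
           (\<forall>i<n. \<forall>p<r. \<forall>t<s. \<Phi> p t (zs i) = W i p t)))"

definition mult_ideal :: "(complex^'d \<Rightarrow> complex^'d \<Rightarrow> complex) \<Rightarrow> (complex^'d \<Rightarrow> complex) set \<Rightarrow> bool" where
  "mult_ideal K A \<longleftrightarrow> A \<subseteq> mult_alg K \<and> (\<lambda>z. 0) \<in> A \<and>
     (\<forall>f\<in>A. \<forall>g\<in>A. (\<lambda>z. f z + g z) \<in> A) \<and>
     (\<forall>f\<in>A. \<forall>g\<in>mult_alg K. (\<lambda>z. g z * f z) \<in> A)"

text \<open>sigma-weak (weak-*) topology of B(H), restricted to M(H): functionals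
  T \<mapsto> sum_n <T x_n, y_n> with sum ||x_n||^2, sum ||y_n||^2 finite.\<close>
definition swseq :: "(complex^'d \<Rightarrow> complex^'d \<Rightarrow> complex) \<Rightarrow> (nat \<Rightarrow> complex^'d \<Rightarrow> complex) \<Rightarrow> (nat \<Rightarrow> complex^'d \<Rightarrow> complex) \<Rightarrow> bool" where
  "swseq K x y \<longleftrightarrow> (\<forall>n. x n \<in> rkhs K \<and> y n \<in> rkhs K) \<and>
     summable (\<lambda>n. (hnorm K (x n))^2) \<and> summable (\<lambda>n. (hnorm K (y n))^2)"

definition swfun :: "(complex^'d \<Rightarrow> complex^'d \<Rightarrow> complex) \<Rightarrow> (nat \<Rightarrow> complex^'d \<Rightarrow> complex) \<Rightarrow> (nat \<Rightarrow> complex^'d \<Rightarrow> complex) \<Rightarrow> (complex^'d \<Rightarrow> complex) \<Rightarrow> complex" where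
  "swfun K x y \<phi> = (\<Sum>n. hinner K (\<lambda>z. \<phi> z * x n z) (y n))"

definition wstar_closure :: "(complex^'d \<Rightarrow> complex^'d \<Rightarrow> complex) \<Rightarrow> (complex^'d \<Rightarrow> complex) set \<Rightarrow> (complex^'d \<Rightarrow> complex) set" where
  "wstar_closure K S = {\<phi> \<in> mult_alg K. \<forall>(m::nat) X Y (\<epsilon>::real). 0 < \<epsilon> \<and> (\<forall>k<m. swseq K (X k) (Y k)) \<longrightarrow>
      (\<exists>\<psi>\<in>S. \<forall>k<m. cmod (swfun K (X k) (Y k) \<phi> - swfun K (X k) (Y k) \<psi>) < \<epsilon>)}"

definition wstar_closed :: "(complex^'d \<Rightarrow> complex^'d \<Rightarrow> complex) \<Rightarrow> (complex^'d \<Rightarrow> complex) set \<Rightarrow> bool" where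
  "wstar_closed K S \<longleftrightarrow> wstar_closure K S \<subseteq> S"

definition bconst :: "complex \<Rightarrow> complex^'d \<Rightarrow> complex" where
  "bconst c = (\<lambda>w. if w \<in> bball then c else 0)"

definition bcoord :: "'d \<Rightarrow> complex^'d \<Rightarrow> complex" where
  "bcoord j = (\<lambda>w. if w \<in> bball then w$j else 0)"

definition supp :: "(complex^'d \<Rightarrow> complex^'d \<Rightarrow> complex) \<Rightarrow> (complex^'d \<Rightarrow> complex) set \<Rightarrow> (complex^'d) set" where
  "supp K A = {z. bconst 1 \<notin> {(\<lambda>w. f w + (\<Sum>j\<in>UNIV. (bcoord j w - bconst (z$j) w) * g j w)) | f g.
       f \<in> A \<and> (\<forall>j. g j \<in> mult_alg K)}}"

definition zero_set :: "(complex^'d \<Rightarrow> complex) set \<Rightarrow> (complex^'d) set" where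
  "zero_set A = {z \<in> bball. \<forall>f\<in>A. f z = 0}"

definition ideal_prod :: "('a \<Rightarrow> complex) set \<Rightarrow> ('a \<Rightarrow> complex) set \<Rightarrow> ('a \<Rightarrow> complex) set" where
  "ideal_prod A B = {(\<lambda>z. \<Sum>i<n. f i z * g i z) | (n::nat) f g. \<forall>i<n. f i \<in> A \<and> g i \<in> B}"

definition ideal_sum :: "('a \<Rightarrow> complex) set \<Rightarrow> ('a \<Rightarrow> complex) set \<Rightarrow> ('a \<Rightarrow> complex) set" where
  "ideal_sum A B = {(\<lambda>z. f z + g z) | f g. f \<in> A \<and> g \<in> B}"

end

theory Submission
  imports Defs "HOL-Library.Complex_Order"
begin

text \<open>
  Everything except the description of the support inside and outside the ball is ideal arithmetic;
  in particular the weak-* closure of a product of closed ideals lies in their intersection.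

  For a point p of the ball the issue is Gleason's problem: a multiplier h vanishing at p must be
  written as the sum of (x_j - p_j) g_j with multipliers g_j. Write D for the kernel
  <z - p, w - p>. Since a_n / a_(n+1) tends to 1, the kernel D K dominates K up to a finite
  sum of powers of <z, w>, hence up to a constant, and testing against vectors orthogonal to the
  constants shows that D K dominates K minus its rank one part at p; that in turn
  dominates h(z) h(w)^* K because h is a bounded multiplier vanishing at p. A Leech type
  factorisation then produces the g_j: the values of the row multiplier are prescribed one
  point and one direction at a time, each step being a Parrott extension whose
  solvability is the Schur product theorem applied to the complete Pick kernel. That the interpolation
  property forces 1 - K(x,p) K(p,y) / (K(x,y) K(p,p)) to be positive is the McCullough--Quiggin theorem,
  proved by induction on the number of points.

  For p outside the closed ball, 1 - (<z, p> / |p|^2)^n lies in the ideal of the shifted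
  coordinates and is invertible for large n.
\<close>

section \<open>Positive semidefinite kernels\<close>

text \<open>The argument works without operators or adjoints. Membership in the space, norms and
  multipliers are all expressed by positivity of kernels at finitely many points, so each operator
  inequality becomes a statement about \<open>qform\<close>, where \<open>0 \<le> z\<close> for a
  complex z means real and nonnegative. Two difficulties shape the rest. A multiplier is only
  required to map the space into itself, so the boundedness on which every estimate rests must be
  proved. And K is not dominated by a multiple of D K, since D K vanishes at (p, p) and K does not.
  This is why the rank one part of K at p is subtracted: afterwards both kernels have zero row and
  column at p, the coefficient of a test vector at p has no influence, and it can be chosen so that
  an unwanted rank one term disappears. The same freedom shows that a contractive multiplier stays
  contractive on the functions vanishing at a point, which is what drives the passage from
  interpolation to the complete Pick kernel.\<close>

definition qform :: "'a set \<Rightarrow> ('a \<Rightarrow> complex) \<Rightarrow> ('a \<Rightarrow> 'a \<Rightarrow> complex) \<Rightarrow> complex" where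
  "qform F c L = (\<Sum>x\<in>F. \<Sum>y\<in>F. c x * cnj (c y) * L x y)"

text \<open>The definition allows repeated points. Passing to finite sets is harmless because
  coefficients at coinciding points can be added.\<close>

lemma psd_on_iff:
  "psd_on S L \<longleftrightarrow> (\<forall>F c. finite F \<longrightarrow> F \<subseteq> S \<longrightarrow> 0 \<le> qform F c L)"
proof
  assume psd: "psd_on S L"
  show "\<forall>F c. finite F \<longrightarrow> F \<subseteq> S \<longrightarrow> 0 \<le> qform F c L"
  proof (intro allI impI)
    fix F :: "'a set" and c :: "'a \<Rightarrow> complex"
    assume F: "finite F" "F \<subseteq> S"
    obtain h where h: "bij_betw h {..<card F} F"
      using ex_bij_betw_nat_finite[OF F(1)] by (auto simp: atLeast0LessThan)
    have "qform F c L = (\<Sum>i<card F. \<Sum>j<card F. c (h i) * cnj (c (h j)) * L (h i) (h j))"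
      unfolding qform_def by (simp only: sum.reindex_bij_betw[OF h, symmetric])
    moreover have "\<forall>i<card F. h i \<in> S"
      using h F(2) by (auto dest: bij_betwE)
    ultimately show "0 \<le> qform F c L"
      using psd[unfolded psd_on_def, rule_format, of "card F" h "c \<circ> h"]
      by (simp add: less_eq_complex_def Let_def)
  qed
next
  assume R: "\<forall>F c. finite F \<longrightarrow> F \<subseteq> S \<longrightarrow> 0 \<le> qform F c L"
  show "psd_on S L"
    unfolding psd_on_def
  proof (intro allI impI)
    fix n and z :: "nat \<Rightarrow> 'a" and c :: "nat \<Rightarrow> complex"
    assume z: "\<forall>i<n. z i \<in> S"
    \<comment> \<open>Total coefficient of all indices whose point is x.\<close>
    define C where "C x = (\<Sum>i | i \<in> {..<n} \<and> z i = x. c i)" for x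
    have collect: "(\<Sum>i<n. c i * g (z i)) = (\<Sum>x\<in>z ` {..<n}. C x * g x)" for g :: "'a \<Rightarrow> complex"
      unfolding C_def sum_distrib_right
      by (subst sum.image_gen[OF finite_lessThan, where g = z], intro sum.cong refl) auto
    have collect': "(\<Sum>i<n. cnj (c i) * g (z i)) = (\<Sum>x\<in>z ` {..<n}. cnj (C x) * g x)" for g :: "'a \<Rightarrow> complex"
      using arg_cong[OF collect[of "\<lambda>x. cnj (g x)"], of cnj] by simp
    have "(\<Sum>i<n. \<Sum>j<n. c i * cnj (c j) * L (z i) (z j))
        = (\<Sum>i<n. c i * (\<Sum>j<n. cnj (c j) * L (z i) (z j)))"
      by (simp add: sum_distrib_left mult.assoc)
    also have "\<dots> = (\<Sum>x\<in>z ` {..<n}. C x * (\<Sum>y\<in>z ` {..<n}. cnj (C y) * L x y))"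
      by (subst collect, subst collect') (rule refl)
    also have "\<dots> = qform (z ` {..<n}) C L"
      by (simp add: qform_def sum_distrib_left mult.assoc)
    finally show "let q = (\<Sum>i<n. \<Sum>j<n. c i * cnj (c j) * L (z i) (z j)) in Im q = 0 \<and> 0 \<le> Re q"
      using R[rule_format, of "z ` {..<n}" C] z by (auto simp: less_eq_complex_def)
  qed
qed

lemma psd_onI: "(\<And>F c. finite F \<Longrightarrow> F \<subseteq> S \<Longrightarrow> 0 \<le> qform F c L) \<Longrightarrow> psd_on S L"
  by (simp add: psd_on_iff)

lemma psd_onD: "psd_on S L \<Longrightarrow> finite F \<Longrightarrow> F \<subseteq> S \<Longrightarrow> 0 \<le> qform F c L"
  by (simp add: psd_on_iff)

lemma qform_cong:
  "(\<And>x y. x \<in> F \<Longrightarrow> y \<in> F \<Longrightarrow> L x y = M x y) \<Longrightarrow> (\<And>x. x \<in> F \<Longrightarrow> c x = d x) \<Longrightarrow> qform F c L = qform F d M"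
  unfolding qform_def by (intro sum.cong) auto

lemma psd_on_cong:
  "psd_on S L \<Longrightarrow> (\<And>x y. x \<in> S \<Longrightarrow> y \<in> S \<Longrightarrow> M x y = L x y) \<Longrightarrow> psd_on S M"
  unfolding psd_on_iff by (intro allI impI, subst qform_cong[where M = L]) (blast+)

lemma psd_on_subset: "psd_on S L \<Longrightarrow> T \<subseteq> S \<Longrightarrow> psd_on T L"
  unfolding psd_on_iff by (meson order_trans)

lemma psd_on_pullback: "psd_on S L \<Longrightarrow> h ` T \<subseteq> S \<Longrightarrow> psd_on T (\<lambda>x y. L (h x) (h y))"
  unfolding psd_on_def
  apply (intro allI impI)
  subgoal for n z c
    by (drule spec[of _ n], drule spec[of _ "h \<circ> z"], drule spec[of _ c]) auto
  done

lemma qform_add: "qform F c (\<lambda>x y. L x y + M x y) = qform F c L + qform F c M"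
  by (simp add: qform_def sum.distrib distrib_left)

lemma qform_diff: "qform F c (\<lambda>x y. L x y - M x y) = qform F c L - qform F c M"
  by (simp add: qform_def sum_subtractf right_diff_distrib)

lemma qform_scale: "qform F c (\<lambda>x y. a * L x y) = a * qform F c L"
  by (simp add: qform_def sum_distrib_left mult.left_commute)

lemma qform_sum: "qform F c (\<lambda>x y. \<Sum>i\<in>I. L i x y) = (\<Sum>i\<in>I. qform F c (L i))"
  by (induction I rule: infinite_finite_induct) (simp_all add: qform_add, simp_all add: qform_def)

lemma qform_congruence: "qform F c (\<lambda>x y. f x * L x y * cnj (f y)) = qform F (\<lambda>x. c x * f x) L"
  by (simp add: qform_def mult_ac)

lemma qform_rank_one: "qform F c (\<lambda>x y. f x * cnj (f y)) = complex_of_real ((cmod (\<Sum>x\<in>F. c x * f x))^2)"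
proof -
  have "qform F c (\<lambda>x y. f x * cnj (f y)) = (\<Sum>x\<in>F. c x * f x) * cnj (\<Sum>x\<in>F. c x * f x)"
    by (simp add: qform_def sum_product mult_ac)
  then show ?thesis
    by (simp only: complex_norm_square)
qed

lemma psd_on_add: "psd_on S L \<Longrightarrow> psd_on S M \<Longrightarrow> psd_on S (\<lambda>x y. L x y + M x y)"
  by (simp add: psd_on_iff qform_add)

lemma psd_on_scale:
  assumes "psd_on S L" "0 \<le> (a::complex)"
  shows "psd_on S (\<lambda>x y. a * L x y)"
  using assms by (simp add: psd_on_iff qform_scale)

lemma psd_on_sum: "(\<And>i. i \<in> I \<Longrightarrow> psd_on S (L i)) \<Longrightarrow> psd_on S (\<lambda>x y. \<Sum>i\<in>I. L i x y)"
  by (simp add: psd_on_iff qform_sum sum_nonneg)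

lemma psd_on_zero: "psd_on S (\<lambda>x y. 0)"
  by (simp add: psd_on_iff qform_def)

lemma psd_on_rank_one: "psd_on S (\<lambda>x y. f x * cnj (f y))"
  by (simp add: psd_on_iff qform_rank_one less_eq_complex_def)

lemma psd_on_const: "0 \<le> a \<Longrightarrow> psd_on S (\<lambda>x y. complex_of_real a)"
  using psd_on_rank_one[of S "\<lambda>x. complex_of_real (sqrt a)"]
  by (simp flip: of_real_mult)

lemma psd_on_congruence: "psd_on S L \<Longrightarrow> psd_on S (\<lambda>x y. f x * L x y * cnj (f y))"
  by (simp add: psd_on_iff qform_congruence)

lemma closed_complex_nonneg: "closed {z::complex. 0 \<le> z}"
proof -
  have "{z::complex. 0 \<le> z} = {z. 0 \<le> Re z} \<inter> {z. Im z = 0}"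
    by (auto simp: less_eq_complex_def)
  then show ?thesis
    by (auto intro!: closed_Int closed_Collect_le closed_Collect_eq continuous_intros)
qed

lemma psd_on_limit:
  assumes "\<And>n. psd_on S (L n)"
    and "\<And>x y. x \<in> S \<Longrightarrow> y \<in> S \<Longrightarrow> (\<lambda>n. L n x y) \<longlonglongrightarrow> M x y"
  shows "psd_on S M"
proof (rule psd_onI)
  fix F c assume F: "finite F" "F \<subseteq> S"
  have "(\<lambda>n. qform F c (L n)) \<longlonglongrightarrow> qform F c M"
    unfolding qform_def using F assms(2) by (intro tendsto_intros) auto
  moreover have "\<forall>n. qform F c (L n) \<in> {z. 0 \<le> z}"
    using psd_onD[OF assms(1) F] by simp
  ultimately show "0 \<le> qform F c M"
    using closed_sequentially[OF closed_complex_nonneg, of "\<lambda>n. qform F c (L n)"] by simp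
qed

section \<open>Diagonal entries, symmetry and null points\<close>

lemma psd_on_diag: 
  assumes "psd_on S L" "x \<in> S" shows "0 \<le> L x x"
  using psd_onD[OF assms(1), of "{x}" "\<lambda>_. 1"] assms(2) by (simp add: qform_def)

lemma psd_on_hermitian:
  assumes "psd_on S L" "x \<in> S" "y \<in> S"
  shows "L y x = cnj (L x y)"
proof (cases "x = y")
  case True
  then show ?thesis
    using psd_on_diag[OF assms(1,2)] by (simp add: less_eq_complex_def complex_eq_iff)
next
  case False
  have d: "0 \<le> L x x" "0 \<le> L y y"
    using assms psd_on_diag by fast+
  \<comment> \<open>The vector (1, 1) shows that the imaginary parts of \<open>L x y\<close> and
    \<open>L y x\<close> cancel; (\<i>, 1) shows that their real parts agree.\<close>
  have "0 \<le> qform {x, y} (\<lambda>_. 1) L" "0 \<le> qform {x, y} (\<lambda>z. if z = x then \<i> else 1) L"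
    using assms by (auto intro!: psd_onD)
  with False d show ?thesis
    by (simp add: qform_def less_eq_complex_def complex_eq_iff)
qed

lemma psd_on_null:
  assumes "psd_on S L" "x \<in> S" "p \<in> S" "L p p = 0"
  shows "L x p = 0" "L p x = 0"
proof -
  show *: "L x p = 0"
  proof (cases "x = p")
    case False
    show ?thesis
    proof (rule ccontr)
      assume nz: "L x p \<noteq> 0"
      \<comment> \<open>Chosen so that the two cross terms add up to -2 (L x x + 1), which outweighs
        the diagonal term \<open>L x x\<close>.\<close>
      define s where "s = - complex_of_real ((Re (L x x) + 1) / (cmod (L x p))^2) * L x p"
      have h: "L p x = cnj (L x p)"
        using psd_on_hermitian[OF assms(1-3)] .
      have "0 \<le> qform {x, p} (\<lambda>z. if z = x then 1 else s) L"
        using assms by (auto intro!: psd_onD)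
      also have "qform {x, p} (\<lambda>z. if z = x then 1 else s) L = L x x + (cnj s * L x p + cnj (cnj s * L x p))"
        using False assms(4) h by (simp add: qform_def)
      also have "cnj s * L x p = - complex_of_real ((Re (L x x) + 1) / (cmod (L x p))^2 * (cmod (L x p))^2)"
        unfolding of_real_mult complex_norm_square by (simp add: s_def)
      also have "\<dots> = - complex_of_real (Re (L x x) + 1)"
        using nz by simp
      finally have "Re (L x x) + 2 \<le> 0"
        by (simp add: less_eq_complex_def)
      then show False
        using psd_on_diag[OF assms(1,2)] by (simp add: less_eq_complex_def)
    qed
  qed (use assms in simp)
  then show "L p x = 0"
    using psd_on_hermitian[OF assms(1-3)] by simp
qed

lemma qform_zero_row:
  assumes "finite F" "\<And>x. x \<in> F \<Longrightarrow> L x p = 0" "\<And>x. x \<in> F \<Longrightarrow> L p x = 0"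
  shows "qform F c L = qform (F - {p}) c L"
proof -
  have "qform (F - {p}) c L = (\<Sum>x\<in>F - {p}. \<Sum>y\<in>F. c x * cnj (c y) * L x y)"
    unfolding qform_def using assms
    by (intro sum.cong refl sum.mono_neutral_left) auto
  also have "\<dots> = qform F c L"
    unfolding qform_def using assms
    by (intro sum.mono_neutral_left) (auto intro!: sum.neutral)
  finally show ?thesis by simp
qed

lemma psd_on_insert_zero_row:
  assumes "psd_on S L" "\<And>x. x \<in> insert p S \<Longrightarrow> L x p = 0" "\<And>x. x \<in> insert p S \<Longrightarrow> L p x = 0"
  shows "psd_on (insert p S) L"
proof (rule psd_onI)
  fix F c assume F: "finite F" "F \<subseteq> insert p S"
  have "qform F c L = qform (F - {p}) c L"
    by (rule qform_zero_row) (use F assms in auto)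
  moreover have "F - {p} \<subseteq> S" using F by blast
  ultimately show "0 \<le> qform F c L"
    using psd_onD[OF assms(1), of "F - {p}" c] F(1) by simp
qed

text \<open>The form does not see the coefficient at p, so positivity may be tested with any
  convenient value s there, and s may depend on the other coefficients.\<close>

lemma psd_on_zero_rowI:
  assumes "p \<in> S" "\<And>x. x \<in> S \<Longrightarrow> L x p = 0" "\<And>x. x \<in> S \<Longrightarrow> L p x = 0"
    and *: "\<And>F c. finite F \<Longrightarrow> F \<subseteq> S \<Longrightarrow> p \<notin> F \<Longrightarrow> \<exists>s. 0 \<le> qform (insert p F) (c(p := s)) L"
  shows "psd_on S L"
proof (rule psd_onI)
  fix F :: "'a set" and c :: "'a \<Rightarrow> complex"
  assume F: "finite F" "F \<subseteq> S"
  obtain s where s: "0 \<le> qform (insert p (F - {p})) (c(p := s)) L"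
    using *[of "F - {p}" c] F by blast
  have "qform (insert p (F - {p})) (c(p := s)) L = qform (F - {p}) (c(p := s)) L"
    using F assms(1-3) by (subst qform_zero_row[where p = p]) auto
  also have "\<dots> = qform (F - {p}) c L"
    by (intro qform_cong) auto
  also have "\<dots> = qform F c L"
    using F assms(1-3) by (subst qform_zero_row[where p = p and F = F]) auto
  finally show "0 \<le> qform F c L"
    using s by simp
qed

section \<open>Schur complements at a point\<close>

text \<open>For a reproducing kernel this is the kernel of the subspace of functions vanishing at p.
  If \<open>L p p = 0\<close>, division by zero yields L itself, which is consistent because a
  positive L then has zero row and column at p.\<close>

definition schur_compl :: "('a \<Rightarrow> 'a \<Rightarrow> complex) \<Rightarrow> 'a \<Rightarrow> 'a \<Rightarrow> 'a \<Rightarrow> complex" where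
  "schur_compl L p x y = L x y - L x p * L p y / L p p"

lemma schur_compl_zero:
  assumes "psd_on S L" "x \<in> S" "p \<in> S"
  shows "schur_compl L p x p = 0" "schur_compl L p p x = 0"
  using psd_on_null[OF assms] by (cases "L p p = 0"; simp add: schur_compl_def)+

lemma qform_pairing_rank_one:
  assumes "\<And>y. y \<in> F \<Longrightarrow> L p y = cnj (L y p)" "(\<Sum>x\<in>F. c x * L x p) = 0"
  shows "qform F c (\<lambda>x y. L x p * L p y / k) = 0"
proof -
  have "qform F c (\<lambda>x y. L x p * L p y / k) = qform F c (\<lambda>x y. (1 / k) * (L x p * cnj (L y p)))"
    using assms(1) by (intro qform_cong) auto
  also have "\<dots> = 0"
    unfolding qform_scale qform_rank_one assms(2) by simp
  finally show ?thesis .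
qed

lemma complex_inverse_nonneg: "0 \<le> (z::complex) \<Longrightarrow> 0 \<le> 1 / z"
  by (simp add: less_eq_complex_def Re_divide Im_divide)

text \<open>The coefficient of the base point is chosen so that the test vector becomes orthogonal to
  the kernel function at that point.\<close>
lemma ex_orthogonal_coeff:
  assumes "finite F" "p \<notin> F" "L p p \<noteq> 0"
  shows "\<exists>s. (\<Sum>x\<in>insert p F. (c(p := s)) x * L x p) = (0::complex)"
proof
  have "(\<Sum>x\<in>F. (c(p := s)) x * L x p) = (\<Sum>x\<in>F. c x * L x p)" for s
    using assms by (intro sum.cong) auto
  then show "(\<Sum>x\<in>insert p F. (c(p := - (\<Sum>x\<in>F. c x * L x p) / L p p)) x * L x p) = 0"
    using assms by simp
qed

text \<open>If \<open>Th\<close> is the kernel of a contractive row multiplier, the functions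
  vanishing at p are invariant under it, so it remains contractive there. In formulas, (1 - Th)
  times the Schur complement is (1 - Th) K plus Th times the rank one part, minus the rank one part;
  the last form vanishes once the test vector is orthogonal to the kernel function at p.\<close>

lemma psd_on_schur_compl_mult:
  assumes K: "psd_on S K" and p: "p \<in> S" and Th: "psd_on S Th"
    and R: "psd_on S (\<lambda>x y. (1 - Th x y) * K x y)"
  shows "psd_on S (\<lambda>x y. (1 - Th x y) * schur_compl K p x y)"
proof (cases "K p p = 0")
  case True
  then show ?thesis using R by (simp add: schur_compl_def)
next
  case False
  have prod: "psd_on S (\<lambda>x y. Th x y * (K x p * K p y / K p p))"
  proof -
    have "psd_on S (\<lambda>x y. (1 / K p p) * (K x p * Th x y * cnj (K y p)))"
      using psd_on_diag[OF K p] by (intro psd_on_scale psd_on_congruence Th complex_inverse_nonneg)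
    then show ?thesis
      by (rule psd_on_cong) (use psd_on_hermitian[OF K _ p] in auto)
  qed
  show ?thesis
  proof (rule psd_on_zero_rowI[OF p])
    fix F c assume F: "finite F" "F \<subseteq> S" "p \<notin> F"
    obtain s where s: "(\<Sum>x\<in>insert p F. (c(p := s)) x * K x p) = 0"
      using ex_orthogonal_coeff[of F p K c] F False by blast
    let ?q = "qform (insert p F) (c(p := s))"
    have fin: "finite (insert p F)" "insert p F \<subseteq> S"
      using F p by auto
    have "?q (\<lambda>x y. (1 - Th x y) * schur_compl K p x y)
        = ?q (\<lambda>x y. (1 - Th x y) * K x y + (Th x y * (K x p * K p y / K p p) - K x p * K p y / K p p))"
      by (intro qform_cong) (simp_all add: schur_compl_def algebra_simps add_divide_distrib diff_divide_distrib)
    also have "\<dots> = ?q (\<lambda>x y. (1 - Th x y) * K x y) + ?q (\<lambda>x y. Th x y * (K x p * K p y / K p p))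
        - ?q (\<lambda>x y. K x p * K p y / K p p)"
      by (simp only: qform_add qform_diff add_diff_eq)
    also have "?q (\<lambda>x y. K x p * K p y / K p p) = 0"
    proof (rule qform_pairing_rank_one[where L = K, OF _ s])
      show "K p y = cnj (K y p)" if "y \<in> insert p F" for y
        using that fin(2) psd_on_hermitian[OF K _ p, of y] by blast
    qed
    finally have eq: "?q (\<lambda>x y. (1 - Th x y) * schur_compl K p x y)
      = ?q (\<lambda>x y. (1 - Th x y) * K x y) + ?q (\<lambda>x y. Th x y * (K x p * K p y / K p p))"
      by (simp only: diff_0_right)
    have "0 \<le> ?q (\<lambda>x y. (1 - Th x y) * schur_compl K p x y)"
      unfolding eq by (intro add_nonneg_nonneg psd_onD[OF R fin] psd_onD[OF prod fin])
    then show "\<exists>s. 0 \<le> qform (insert p F) (c(p := s)) (\<lambda>x y. (1 - Th x y) * schur_compl K p x y)" ..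
  qed (use schur_compl_zero[OF K _ p] in auto)
qed

lemma psd_on_schur_compl:
  assumes "psd_on S K" "p \<in> S"
  shows "psd_on S (schur_compl K p)"
  using psd_on_schur_compl_mult[OF assms psd_on_zero] assms(1) by simp

section \<open>Gram factorisation and Schur products\<close>

text \<open>Cholesky factorisation: each point contributes one column, and the Schur complement at
  it is factored by induction.\<close>

lemma psd_on_Gram:
  assumes "finite F" "psd_on F L"
  shows "\<exists>W. \<forall>x\<in>F. \<forall>y\<in>F. L x y = (\<Sum>t<card F. W x t * cnj (W y t))"
  using assms
proof (induction F arbitrary: L rule: finite_induct)
  case empty
  then show ?case by simp
next
  case (insert p F)
  let ?M = "schur_compl L p"
  have "psd_on F ?M"
    using psd_on_schur_compl[OF insert.prems] by (auto intro: psd_on_subset)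
  then obtain W where W: "\<forall>x\<in>F. \<forall>y\<in>F. ?M x y = (\<Sum>t<card F. W x t * cnj (W y t))"
    using insert.IH by blast
  \<comment> \<open>The column with index \<open>card F\<close> carries the rank one part at p; in
    all other columns the row of p is zero. If \<open>L p p = 0\<close> the new column is zero,
    matching the convention in \<open>schur_compl\<close>.\<close>
  define W' where "W' x t = (if t = card F then L x p / complex_of_real (sqrt (Re (L p p)))
      else if x = p then 0 else W x t)" for x t
  have "0 \<le> L p p"
    using psd_on_diag[OF insert.prems, of p] by simp
  then have pp: "complex_of_real (Re (L p p)) = L p p" "0 \<le> Re (L p p)"
    by (auto simp: less_eq_complex_def complex_eq_iff)
  have "L x y = (\<Sum>t<card (insert p F). W' x t * cnj (W' y t))"
    if xy: "x \<in> insert p F" "y \<in> insert p F" for x y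
  proof -
    have "(\<Sum>t<card F. W' x t * cnj (W' y t)) = ?M x y"
    proof (cases "x = p \<or> y = p")
      case True
      then have "?M x y = 0"
        using schur_compl_zero[OF insert.prems, of _ p] xy by auto
      with True show ?thesis by (auto simp: W'_def)
    next
      case False
      then have "(\<Sum>t<card F. W' x t * cnj (W' y t)) = (\<Sum>t<card F. W x t * cnj (W y t))"
        by (intro sum.cong) (auto simp: W'_def)
      with False W xy show ?thesis by auto
    qed
    moreover have "W' x (card F) * cnj (W' y (card F)) = L x p * L p y / L p p"
    proof -
      have "W' x (card F) * cnj (W' y (card F)) = L x p * cnj (L y p) / complex_of_real (sqrt (Re (L p p)) * sqrt (Re (L p p)))"
        by (simp add: W'_def del: real_sqrt_mult_self)
      also have "\<dots> = L x p * cnj (L y p) / L p p"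
        using pp by (simp only: real_sqrt_mult_self abs_of_nonneg)
      also have "cnj (L y p) = L p y"
        using psd_on_hermitian[OF insert.prems xy(2), of p] by simp
      finally show ?thesis .
    qed
    ultimately show ?thesis
      using insert.hyps by (simp add: schur_compl_def)
  qed
  then show ?case by blast
qed

text \<open>Schur product theorem: a Gram factorisation of M turns the product into a sum of
  congruences of L.\<close>

lemma psd_on_mult:
  assumes L: "psd_on S L" and M: "psd_on S M"
  shows "psd_on S (\<lambda>x y. L x y * M x y)"
proof (rule psd_onI)
  fix F c assume F: "finite F" "F \<subseteq> S"
  obtain W where W: "\<forall>x\<in>F. \<forall>y\<in>F. M x y = (\<Sum>t<card F. W x t * cnj (W y t))"
    using psd_on_Gram[OF F(1) psd_on_subset[OF M F(2)]] by blast
  have "qform F c (\<lambda>x y. L x y * M x y) = qform F c (\<lambda>x y. \<Sum>t<card F. W x t * L x y * cnj (W y t))"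
    using W by (intro qform_cong) (auto simp: sum_distrib_left mult_ac)
  then show "0 \<le> qform F c (\<lambda>x y. L x y * M x y)"
    using psd_onD[OF L F] by (simp add: qform_sum qform_congruence sum_nonneg)
qed

lemma psd_on_power: "psd_on S L \<Longrightarrow> psd_on S (\<lambda>x y. L x y ^ n)"
  by (induction n) (use psd_on_const[of 1 S] in \<open>simp_all add: psd_on_mult\<close>)

section \<open>Projections and extension of dominated functionals\<close>

text \<open>The c are coefficients of the orthogonal projection of the vector at e onto the span of
  the vectors at F. Eliminating one point at a time solves the normal equations even when the Gram
  matrix is singular.\<close>

lemma psd_on_projection:
  assumes "finite F" "psd_on S N" "F \<subseteq> S" "e \<in> S"
  shows "\<exists>c. \<forall>l\<in>F. (\<Sum>k\<in>F. c k * N k l) = N e l"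
  using assms
proof (induction F arbitrary: N rule: finite_induct)
  case empty
  then show ?case by simp
next
  case (insert a F)
  have a: "a \<in> S" using insert.prems by simp
  obtain c where c: "\<forall>l\<in>F. (\<Sum>k\<in>F. c k * schur_compl N a k l) = schur_compl N a e l"
    using insert.IH[OF psd_on_schur_compl[OF insert.prems(1) a]] insert.prems by auto
  define s where "s = (\<Sum>k\<in>F. c k * N k a)"
  \<comment> \<open>Solves the equation for l = a. When \<open>N a a = 0\<close> that equation reads
    0 = 0, because a is then a null point.\<close>
  define c' where "c' = c(a := (N e a - s) / N a a)"
  have split: "(\<Sum>k\<in>insert a F. c' k * N k l) = (N e a - s) / N a a * N a l + (\<Sum>k\<in>F. c k * N k l)" for l
  proof -
    have "(\<Sum>k\<in>F. c' k * N k l) = (\<Sum>k\<in>F. c k * N k l)"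
      using insert.hyps by (intro sum.cong) (auto simp: c'_def)
    then show ?thesis
      using insert.hyps by (simp add: c'_def)
  qed
  have "(\<Sum>k\<in>insert a F. c' k * N k l) = N e l" if l: "l \<in> insert a F" for l
  proof (cases "l = a")
    case True
    have "N e a = 0" "s = 0" if "N a a = 0"
      using that psd_on_null[OF insert.prems(1) _ a] insert.prems by (auto simp: s_def intro!: sum.neutral)
    with True show ?thesis
      by (subst split, cases "N a a = 0") (simp_all flip: s_def)
  next
    case False
    with l have "l \<in> F" by simp
    with c have "(\<Sum>k\<in>F. c k * schur_compl N a k l) = N e l - N e a * N a l / N a a"
      by (simp add: schur_compl_def)
    moreover have "(\<Sum>k\<in>F. c k * schur_compl N a k l) = (\<Sum>k\<in>F. c k * N k l) - s * N a l / N a a"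
      by (simp add: schur_compl_def right_diff_distrib sum_subtractf s_def sum_distrib_right sum_divide_distrib mult.assoc)
    ultimately show ?thesis
      by (subst split) (simp add: diff_divide_distrib left_diff_distrib diff_eq_eq)
  qed
  then show ?case by blast
qed

lemma psd_on_finite_iff:
  assumes "finite S"
  shows "psd_on S L \<longleftrightarrow> (\<forall>c. 0 \<le> qform S c L)"
proof
  assume *: "\<forall>c. 0 \<le> qform S c L"
  show "psd_on S L"
  proof (rule psd_onI)
    fix F :: "'a set" and c :: "'a \<Rightarrow> complex"
    assume F: "F \<subseteq> S"
    let ?c = "\<lambda>x. if x \<in> F then c x else 0"
    have "qform S ?c L = (\<Sum>x\<in>F. \<Sum>y\<in>S. ?c x * cnj (?c y) * L x y)"
      unfolding qform_def using F assms by (intro sum.mono_neutral_right) auto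
    also have "\<dots> = (\<Sum>x\<in>F. \<Sum>y\<in>F. ?c x * cnj (?c y) * L x y)"
      using F assms by (intro sum.cong refl sum.mono_neutral_right) auto
    also have "\<dots> = qform F c L"
      unfolding qform_def by (intro sum.cong) auto
    finally show "0 \<le> qform F c L"
      using * by metis
  qed
qed (use assms in \<open>simp add: psd_onD\<close>)

text \<open>This is the Gram matrix of the linear combinations with coefficients \<open>u x\<close>
  of the vectors represented by L.\<close>

lemma psd_on_compress:
  assumes "finite T" "psd_on T L"
  shows "psd_on S (\<lambda>x y. \<Sum>k\<in>T. \<Sum>l\<in>T. u x k * cnj (u y l) * L k l)"
proof -
  obtain W where W: "\<forall>x\<in>T. \<forall>y\<in>T. L x y = (\<Sum>t<card T. W x t * cnj (W y t))"
    using psd_on_Gram[OF assms] by blast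
  have "(\<Sum>k\<in>T. \<Sum>l\<in>T. u x k * cnj (u y l) * L k l)
      = (\<Sum>t<card T. (\<Sum>k\<in>T. u x k * W k t) * cnj (\<Sum>l\<in>T. u y l * W l t))" for x y
  proof -
    have "(\<Sum>k\<in>T. \<Sum>l\<in>T. u x k * cnj (u y l) * L k l)
      = (\<Sum>k\<in>T. \<Sum>l\<in>T. \<Sum>t<card T. (u x k * W k t) * (cnj (u y l) * cnj (W l t)))"
      using W by (intro sum.cong refl) (simp add: sum_distrib_left mult_ac)
    also have "\<dots> = (\<Sum>t<card T. \<Sum>k\<in>T. \<Sum>l\<in>T. (u x k * W k t) * (cnj (u y l) * cnj (W l t)))"
      by (subst sum.swap[where B = "{..<card T}"], subst sum.swap[where A = T and B = "{..<card T}"]) (rule refl)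
    finally show ?thesis
      by (simp add: sum_product)
  qed
  moreover have "psd_on S (\<lambda>x y. \<Sum>t<card T. (\<Sum>k\<in>T. u x k * W k t) * cnj (\<Sum>l\<in>T. u y l * W l t))"
    by (intro psd_on_sum psd_on_rank_one)
  ultimately show ?thesis
    by (simp only:)
qed

text \<open>A functional of norm at most one on the span of T is extended by composing it with the
  orthogonal projection. The new positivity is that of T compressed by the projection, plus the
  squared distance of e from the span in the corner.\<close>

lemma psd_on_extend_functional_finite:
  assumes T: "finite T" "e \<notin> T" and N: "psd_on (insert e T) N"
    and dom: "psd_on T (\<lambda>x y. N x y - \<rho> x * cnj (\<rho> y))"
  shows "\<exists>r. psd_on (insert e T) (\<lambda>x y. N x y - (\<rho>(e := r)) x * cnj ((\<rho>(e := r)) y))"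
proof -
  obtain c where c: "\<And>l. l \<in> T \<Longrightarrow> (\<Sum>k\<in>T. c k * N k l) = N e l"
    using psd_on_projection[OF T(1) N, of e] by auto
  have herm: "N y x = cnj (N x y)" if "x \<in> insert e T" "y \<in> insert e T" for x y
    using psd_on_hermitian[OF N that] .
  define \<nu> where "\<nu> = (\<Sum>l\<in>T. cnj (c l) * N e l)"
  have c': "(\<Sum>l\<in>T. cnj (c l) * N k l) = N k e" if "k \<in> T" for k
  proof -
    have "cnj (\<Sum>l\<in>T. c l * N l k) = (\<Sum>l\<in>T. cnj (c l) * N k l)"
      unfolding cnj_sum complex_cnj_mult
    proof (intro sum.cong refl)
      fix l assume "l \<in> T"
      with that have "N k l = cnj (N l k)" by (intro herm) auto
      then show "cnj (c l) * cnj (N l k) = cnj (c l) * N k l" by simp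
    qed
    then show ?thesis using c[OF that] herm[of e k] that by simp
  qed
  have double: "(\<Sum>k\<in>T. \<Sum>l\<in>T. c k * cnj (c l) * N k l) = \<nu>"
  proof -
    have "(\<Sum>k\<in>T. \<Sum>l\<in>T. c k * cnj (c l) * N k l) = (\<Sum>l\<in>T. cnj (c l) * (\<Sum>k\<in>T. c k * N k l))"
      by (subst sum.swap) (simp add: sum_distrib_left mult_ac)
    then show ?thesis by (simp add: c \<nu>_def)
  qed
  have double': "(\<Sum>k\<in>T. c k * N k e) = \<nu>"
  proof -
    have "(\<Sum>k\<in>T. \<Sum>l\<in>T. c k * cnj (c l) * N k l) = (\<Sum>k\<in>T. c k * (\<Sum>l\<in>T. cnj (c l) * N k l))"
      by (simp add: sum_distrib_left mult_ac)
    then show ?thesis using double by (simp add: c')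
  qed
  \<comment> \<open>The vector at e minus its projection. Its form is \<open>N e e - \<nu>\<close>,
    the squared distance from e to the span of T, since \<open>\<nu>\<close> is the squared norm of
    the projection.\<close>
  let ?d = "\<lambda>k. if k = e then 1 else - c k"
  have sumd: "(\<Sum>k\<in>T. ?d k * g k) = - (\<Sum>k\<in>T. c k * g k)" "(\<Sum>k\<in>T. cnj (?d k) * g k) = - (\<Sum>k\<in>T. cnj (c k) * g k)" for g
    unfolding sum_negf[symmetric] using T by (auto intro!: sum.cong)
  have "0 \<le> qform (insert e T) ?d N"
    using T by (intro psd_onD[OF N]) auto
  also have "qform (insert e T) ?d N = (\<Sum>x\<in>insert e T. ?d x * (\<Sum>y\<in>insert e T. cnj (?d y) * N x y))"
    by (simp add: qform_def sum_distrib_left mult_ac)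
  also have "\<dots> = (\<Sum>x\<in>insert e T. ?d x * (N x e - (\<Sum>y\<in>T. cnj (c y) * N x y)))"
    using T by (subst sum.insert, simp, simp, subst sumd) simp
  also have "\<dots> = N e e - \<nu>"
    using T by (subst sum.insert, simp, simp, subst sumd) (simp add: c' \<nu>_def)
  finally have gap: "0 \<le> N e e - \<nu>" .
  define r where "r = (\<Sum>k\<in>T. c k * \<rho> k)"
  \<comment> \<open>Row e holds the coefficients of the projection of e; the row of a point of T is
    that point itself. Compressing N by u therefore changes only the corner entry, from
    \<open>N e e\<close> to \<open>\<nu>\<close>.\<close>
  define u where "u x k = (if x = e then c k else if x = k then 1 else 0)" for x k
  let ?M = "\<lambda>k l. N k l - \<rho> k * cnj (\<rho> l)"
  have u_e: "(\<Sum>k\<in>T. u e k * g k) = (\<Sum>k\<in>T. c k * g k)" "(\<Sum>k\<in>T. cnj (u e k) * g k) = (\<Sum>k\<in>T. cnj (c k) * g k)" for g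
    by (simp_all add: u_def)
  have u_T: "(\<Sum>k\<in>T. u x k * g k) = g x" "(\<Sum>k\<in>T. cnj (u x k) * g k) = g x" if "x \<in> T" for x g
  proof -
    have "u x k * h k = (if k = x then h x else 0)" "cnj (u x k) * h k = (if k = x then h x else 0)" for k h
      using that T(2) by (auto simp: u_def)
    then show "(\<Sum>k\<in>T. u x k * g k) = g x" "(\<Sum>k\<in>T. cnj (u x k) * g k) = g x"
      using that T(1) by simp_all
  qed
  have u_double: "(\<Sum>k\<in>T. \<Sum>l\<in>T. u x k * cnj (u y l) * g k l) = (\<Sum>k\<in>T. u x k * (\<Sum>l\<in>T. cnj (u y l) * g k l))" for x y g
    by (simp add: sum_distrib_left mult_ac)
  have compN: "(\<Sum>k\<in>T. u x k * (\<Sum>l\<in>T. cnj (u y l) * N k l)) = (if x = e \<and> y = e then \<nu> else N x y)"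
    if "x \<in> insert e T" "y \<in> insert e T" for x y
    using that T(2) c c' double' by (auto simp: u_e u_T \<nu>_def)
  have compR: "(\<Sum>k\<in>T. u x k * (\<Sum>l\<in>T. cnj (u y l) * (\<rho> k * cnj (\<rho> l)))) = (\<rho>(e := r)) x * cnj ((\<rho>(e := r)) y)"
    if "x \<in> insert e T" "y \<in> insert e T" for x y
  proof -
    have "(\<Sum>k\<in>T. u x k * (\<Sum>l\<in>T. cnj (u y l) * (\<rho> k * cnj (\<rho> l))))
        = (\<Sum>k\<in>T. u x k * \<rho> k) * cnj (\<Sum>l\<in>T. u y l * \<rho> l)"
      unfolding cnj_sum sum_product by (simp add: sum_distrib_left mult_ac)
    then show ?thesis
      using that T(2) by (auto simp: u_e u_T r_def simp del: cnj_sum)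
  qed
  have "psd_on (insert e T) (\<lambda>x y. (\<Sum>k\<in>T. \<Sum>l\<in>T. u x k * cnj (u y l) * ?M k l)
      + (N e e - \<nu>) * ((if x = e then 1 else 0) * cnj (if y = e then 1 else 0)))"
    by (intro psd_on_add psd_on_compress psd_on_scale psd_on_rank_one T dom gap)
  then have "psd_on (insert e T) (\<lambda>x y. N x y - (\<rho>(e := r)) x * cnj ((\<rho>(e := r)) y))"
  proof (rule psd_on_cong)
    fix x y assume xy: "x \<in> insert e T" "y \<in> insert e T"
    have "(\<Sum>k\<in>T. \<Sum>l\<in>T. u x k * cnj (u y l) * ?M k l)
       = (if x = e \<and> y = e then \<nu> else N x y) - (\<rho>(e := r)) x * cnj ((\<rho>(e := r)) y)"
      unfolding compN[OF xy, symmetric] compR[OF xy, symmetric] u_double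
      by (simp add: right_diff_distrib sum_subtractf)
    then show "N x y - (\<rho>(e := r)) x * cnj ((\<rho>(e := r)) y) = (\<Sum>k\<in>T. \<Sum>l\<in>T. u x k * cnj (u y l) * ?M k l)
      + (N e e - \<nu>) * ((if x = e then 1 else 0) * cnj (if y = e then 1 else 0))"
      by auto
  qed
  then show ?thesis by blast
qed

text \<open>For each finite part of T the admissible values r form a nonempty compact set, and these
  sets shrink as the part grows, so compactness gives a value that is good for all of them.\<close>

lemma psd_on_extend_functional:
  assumes e: "e \<notin> T" and N: "psd_on (insert e T) N"
    and dom: "psd_on T (\<lambda>x y. N x y - \<rho> x * cnj (\<rho> y))"
  shows "\<exists>r. psd_on (insert e T) (\<lambda>x y. N x y - (\<rho>(e := r)) x * cnj ((\<rho>(e := r)) y))"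
proof -
  let ?M = "\<lambda>r x y. N x y - (\<rho>(e := r)) x * cnj ((\<rho>(e := r)) y)"
  define \<Gamma> where "\<Gamma> F = {r. psd_on (insert e F) (?M r)}" for F
  have mono: "\<Gamma> G \<subseteq> \<Gamma> F" if "F \<subseteq> G" for F G
    using that unfolding \<Gamma>_def by (auto elim!: psd_on_subset)
  have ne: "\<Gamma> F \<noteq> {}" if "finite F" "F \<subseteq> T" for F
  proof -
    have "psd_on (insert e F) N" "psd_on F (\<lambda>x y. N x y - \<rho> x * cnj (\<rho> y))"
      using N dom that by (auto intro: psd_on_subset)
    then show ?thesis
      unfolding \<Gamma>_def using psd_on_extend_functional_finite[of F e N \<rho>] that e by auto
  qed
  have cpt: "compact (\<Gamma> F)" if "finite F" "F \<subseteq> T" for F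
  proof -
    have "continuous_on UNIV (\<lambda>r. (\<rho>(e := r)) x)" for x
      by (cases "x = e") auto
    then have "continuous_on UNIV (\<lambda>r. qform (insert e F) c (?M r))" for c
      unfolding qform_def by (intro continuous_intros)
    then have "closed ((\<lambda>r. qform (insert e F) c (?M r)) -` {z. 0 \<le> z})" for c
      using closed_complex_nonneg closed_vimage by blast
    then have "closed (\<Inter>c. (\<lambda>r. qform (insert e F) c (?M r)) -` {z. 0 \<le> z})"
      by blast
    also have "(\<Inter>c. (\<lambda>r. qform (insert e F) c (?M r)) -` {z. 0 \<le> z}) = \<Gamma> F"
      using that by (auto simp: \<Gamma>_def psd_on_finite_iff)
    finally have "closed (\<Gamma> F)" .
    \<comment> \<open>The diagonal entry at e already bounds the modulus of r.\<close>
    moreover have "\<Gamma> F \<subseteq> cball 0 (sqrt (Re (N e e)))"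
    proof
      fix r assume "r \<in> \<Gamma> F"
      then have "0 \<le> N e e - r * cnj r"
        using psd_on_diag[of "insert e F" "?M r" e] by (simp add: \<Gamma>_def)
      then have "(cmod r)^2 \<le> Re (N e e)"
        by (simp add: less_eq_complex_def flip: complex_norm_square)
      then show "r \<in> cball 0 (sqrt (Re (N e e)))"
        using real_le_rsqrt by simp
    qed
    ultimately show ?thesis
      by (meson bounded_cball bounded_subset compact_eq_bounded_closed)
  qed
  have "\<Inter>(\<Gamma> ` {F. finite F \<and> F \<subseteq> T}) \<noteq> {}"
  proof (rule compact_fip_Heine_Borel)
    fix \<F> assume "finite \<F>" "\<F> \<subseteq> \<Gamma> ` {F. finite F \<and> F \<subseteq> T}"
    then obtain \<G> where \<G>: "finite \<G>" "\<G> \<subseteq> {F. finite F \<and> F \<subseteq> T}" "\<F> = \<Gamma> ` \<G>"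
      by (meson finite_subset_image)
    then have "\<Gamma> (\<Union>\<G>) \<noteq> {}"
      by (intro ne) auto
    moreover have "\<Gamma> (\<Union>\<G>) \<subseteq> \<Inter>\<F>"
      using mono[OF Union_upper] unfolding \<G>(3) by blast
    ultimately show "\<Inter>\<F> \<noteq> {}" by blast
  qed (use cpt in auto)
  then obtain r where r: "\<And>F. finite F \<Longrightarrow> F \<subseteq> T \<Longrightarrow> psd_on (insert e F) (?M r)"
    by (auto simp: \<Gamma>_def)
  have "psd_on (insert e T) (?M r)"
  proof (rule psd_onI)
    fix F c assume F: "finite F" "F \<subseteq> insert e T"
    have "psd_on (insert e (F - {e})) (?M r)"
      by (rule r) (use F in auto)
    then show "0 \<le> qform F c (?M r)"
      by (rule psd_onD) (use F in auto)
  qed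
  then show ?thesis by blast
qed

section \<open>Cauchy--Schwarz inequalities\<close>

lemma psd_on_Cauchy_Schwarz_entry:
  assumes "psd_on S L" "x \<in> S" "y \<in> S"
  shows "(cmod (L x y))^2 \<le> Re (L x x) * Re (L y y)"
proof (cases "L y y = 0")
  case True
  then show ?thesis using psd_on_null(1)[OF assms] by simp
next
  case False
  have d: "0 \<le> L y y" using assms psd_on_diag by fast
  with False have pos: "0 < Re (L y y)" "L y y = complex_of_real (Re (L y y))"
    by (auto simp: less_eq_complex_def complex_eq_iff order_less_le)
  have "0 \<le> schur_compl L y x x"
    using psd_on_diag[OF psd_on_schur_compl[OF assms(1,3)] assms(2)] .
  moreover have "L x y * L y x / L y y = complex_of_real ((cmod (L x y))^2 / Re (L y y))"
    using psd_on_hermitian[OF assms] pos(2) by (metis complex_norm_square of_real_divide)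
  ultimately have "(cmod (L x y))^2 / Re (L y y) \<le> Re (L x x)"
    by (simp add: schur_compl_def less_eq_complex_def)
  with pos show ?thesis by (simp add: divide_le_eq)
qed

lemma psd_on_Cauchy_Schwarz:
  assumes L: "psd_on S L" and "finite F" "F \<subseteq> S" "finite G" "G \<subseteq> S"
  shows "cmod (\<Sum>x\<in>F. \<Sum>y\<in>G. c x * cnj (d y) * L x y)
    \<le> sqrt (Re (qform F c L)) * sqrt (Re (qform G d L))"
proof -
  \<comment> \<open>Both test vectors are extended by zero to \<open>F \<union> G\<close> and
    indexed by a truth value, so that M is a positive 2 by 2 matrix and the entrywise inequality
    applies.\<close>
  define u where "u b x = (if b then (if x \<in> F then c x else 0) else (if x \<in> G then d x else 0))" for b x
  define M where "M a b = (\<Sum>k\<in>F \<union> G. \<Sum>l\<in>F \<union> G. u a k * cnj (u b l) * L k l)" for a b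
  have fin: "finite (F \<union> G)" using assms by auto
  have "psd_on UNIV M"
    unfolding M_def using assms by (intro psd_on_compress psd_on_subset[OF L]) auto
  then have CS: "(cmod (M True False))^2 \<le> Re (M True True) * Re (M False False)"
    by (rule psd_on_Cauchy_Schwarz_entry) auto
  have "M True False = (\<Sum>x\<in>F. \<Sum>y\<in>F \<union> G. u True x * cnj (u False y) * L x y)"
    unfolding M_def using fin by (intro sum.mono_neutral_right) (auto simp: u_def)
  also have "\<dots> = (\<Sum>x\<in>F. \<Sum>y\<in>G. u True x * cnj (u False y) * L x y)"
    using fin by (intro sum.cong refl sum.mono_neutral_right) (auto simp: u_def)
  also have "\<dots> = (\<Sum>x\<in>F. \<Sum>y\<in>G. c x * cnj (d y) * L x y)"
    by (intro sum.cong refl) (auto simp: u_def)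
  finally have TF: "M True False = (\<Sum>x\<in>F. \<Sum>y\<in>G. c x * cnj (d y) * L x y)" .
  have "M True True = (\<Sum>x\<in>F. \<Sum>y\<in>F \<union> G. u True x * cnj (u True y) * L x y)"
    unfolding M_def using fin by (intro sum.mono_neutral_right) (auto simp: u_def)
  also have "\<dots> = (\<Sum>x\<in>F. \<Sum>y\<in>F. u True x * cnj (u True y) * L x y)"
    using fin by (intro sum.cong refl sum.mono_neutral_right) (auto simp: u_def)
  also have "\<dots> = qform F c L"
    unfolding qform_def by (intro sum.cong refl) (auto simp: u_def)
  finally have TT: "M True True = qform F c L" .
  have "M False False = (\<Sum>x\<in>G. \<Sum>y\<in>F \<union> G. u False x * cnj (u False y) * L x y)"
    unfolding M_def using fin by (intro sum.mono_neutral_right) (auto simp: u_def)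
  also have "\<dots> = (\<Sum>x\<in>G. \<Sum>y\<in>G. u False x * cnj (u False y) * L x y)"
    using fin by (intro sum.cong refl sum.mono_neutral_right) (auto simp: u_def)
  also have "\<dots> = qform G d L"
    unfolding qform_def by (intro sum.cong refl) (auto simp: u_def)
  finally have FF: "M False False = qform G d L" .
  show ?thesis
    using CS unfolding TF TT FF real_sqrt_mult[symmetric] by (rule real_le_rsqrt)
qed

section \<open>The Hilbert function space and its multipliers\<close>

locale pos_kernel =
  fixes K :: "complex^'d \<Rightarrow> complex^'d \<Rightarrow> complex"
  assumes K_psd: "psd_on bball K"
begin

text \<open>The norm in H(K) of the combination of the kernel functions at F with coefficients conjugate to c;
  by duality, hbound f C below says that the norm of f is at most C.\<close>
definition knorm :: "(complex^'d) set \<Rightarrow> (complex^'d \<Rightarrow> complex) \<Rightarrow> real" where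
  "knorm F c = sqrt (Re (qform F c K))"

definition hbound :: "(complex^'d \<Rightarrow> complex) \<Rightarrow> real \<Rightarrow> bool" where
  "hbound f C \<longleftrightarrow> (\<forall>F c. finite F \<longrightarrow> F \<subseteq> bball \<longrightarrow> cmod (\<Sum>x\<in>F. c x * f x) \<le> C * knorm F c)"

lemma hboundD: "hbound f C \<Longrightarrow> finite F \<Longrightarrow> F \<subseteq> bball \<Longrightarrow> cmod (\<Sum>x\<in>F. c x * f x) \<le> C * knorm F c"
  by (simp add: hbound_def)

lemma qform_K_nonneg: "finite F \<Longrightarrow> F \<subseteq> bball \<Longrightarrow> 0 \<le> qform F c K"
  by (rule psd_onD[OF K_psd])

lemma knorm_nonneg: "finite F \<Longrightarrow> F \<subseteq> bball \<Longrightarrow> 0 \<le> knorm F c"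
  using qform_K_nonneg[of F c] by (simp add: knorm_def less_eq_complex_def)

lemma knorm_square: "finite F \<Longrightarrow> F \<subseteq> bball \<Longrightarrow> qform F c K = complex_of_real ((knorm F c)^2)"
  using qform_K_nonneg[of F c] by (simp add: knorm_def less_eq_complex_def complex_eq_iff)

text \<open>The form of f(z) times the conjugate of f(w) is the squared modulus of the pairing of f
  with the test vector, so Aronszajn's condition is the square of the bound in
  \<open>hbound\<close>.\<close>

lemma psd_on_iff_hbound:
  assumes "0 \<le> C"
  shows "psd_on bball (\<lambda>z w. complex_of_real (C^2) * K z w - f z * cnj (f w)) \<longleftrightarrow> hbound f C"
proof -
  have "0 \<le> qform F c (\<lambda>z w. complex_of_real (C^2) * K z w - f z * cnj (f w))
      \<longleftrightarrow> cmod (\<Sum>x\<in>F. c x * f x) \<le> C * knorm F c" if "finite F" "F \<subseteq> bball" for F c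
  proof -
    have "qform F c (\<lambda>z w. complex_of_real (C^2) * K z w - f z * cnj (f w))
        = complex_of_real ((C * knorm F c)^2 - (cmod (\<Sum>x\<in>F. c x * f x))^2)"
      unfolding qform_diff qform_scale qform_rank_one knorm_square[OF that] by (simp add: power_mult_distrib)
    also have "0 \<le> \<dots> \<longleftrightarrow> (cmod (\<Sum>x\<in>F. c x * f x))^2 \<le> (C * knorm F c)^2"
      by (simp add: less_eq_complex_def del: of_real_diff)
    also have "\<dots> \<longleftrightarrow> cmod (\<Sum>x\<in>F. c x * f x) \<le> C * knorm F c"
      using assms knorm_nonneg[OF that] by (intro power_mono_iff) auto
    finally show ?thesis .
  qed
  then show ?thesis
    unfolding psd_on_iff hbound_def by blast
qed

lemma rkhs_iff: "f \<in> rkhs K \<longleftrightarrow> (\<forall>z. z \<notin> bball \<longrightarrow> f z = 0) \<and> (\<exists>C\<ge>0. hbound f C)"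
  using psd_on_iff_hbound unfolding rkhs_def by auto

lemma rkhsI: "(\<And>z. z \<notin> bball \<Longrightarrow> f z = 0) \<Longrightarrow> 0 \<le> C \<Longrightarrow> hbound f C \<Longrightarrow> f \<in> rkhs K"
  by (auto simp: rkhs_iff)

lemma hbound_add: "hbound f C \<Longrightarrow> hbound g D \<Longrightarrow> hbound (\<lambda>z. f z + g z) (C + D)"
  unfolding hbound_def
  by (simp add: distrib_left distrib_right sum.distrib) (meson add_mono norm_triangle_le)

lemma hbound_scale: "hbound f C \<Longrightarrow> hbound (\<lambda>z. a * f z) (cmod a * C)"
proof -
  have "(\<Sum>x\<in>F. c x * (a * f x)) = a * (\<Sum>x\<in>F. c x * f x)" for F c
    by (simp add: sum_distrib_left mult_ac)
  then show "hbound f C \<Longrightarrow> hbound (\<lambda>z. a * f z) (cmod a * C)"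
    unfolding hbound_def by (simp add: norm_mult mult.assoc mult_left_mono)
qed

lemma hbound_mono: "hbound f C \<Longrightarrow> C \<le> D \<Longrightarrow> hbound f D"
  unfolding hbound_def using knorm_nonneg by (meson mult_right_mono order_trans)

lemma hbound_zero: "hbound (\<lambda>z. 0) 0"
  by (simp add: hbound_def)

lemma hbound_limit:
  assumes "\<And>n. hbound (f n) C" "\<And>x. x \<in> bball \<Longrightarrow> (\<lambda>n. f n x) \<longlonglongrightarrow> g x"
  shows "hbound g C"
  unfolding hbound_def
proof (intro allI impI)
  fix F c assume F: "finite F" "F \<subseteq> (bball :: (complex^'d) set)"
  have "(\<lambda>n. cmod (\<Sum>x\<in>F. c x * f n x)) \<longlonglongrightarrow> cmod (\<Sum>x\<in>F. c x * g x)"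
    using F assms(2) by (intro tendsto_intros) auto
  then show "cmod (\<Sum>x\<in>F. c x * g x) \<le> C * knorm F c"
    using hboundD[OF assms(1) F] by (intro LIMSEQ_le_const2) auto
qed

lemma rkhs_zero: "(\<lambda>z. 0) \<in> rkhs K"
  using hbound_zero by (intro rkhsI) auto

lemma rkhs_add: "f \<in> rkhs K \<Longrightarrow> g \<in> rkhs K \<Longrightarrow> (\<lambda>z. f z + g z) \<in> rkhs K"
  unfolding rkhs_iff by (auto intro: hbound_add add_nonneg_nonneg)

lemma rkhs_scale: "f \<in> rkhs K \<Longrightarrow> (\<lambda>z. a * f z) \<in> rkhs K"
  unfolding rkhs_iff by (metis hbound_scale mult_nonneg_nonneg mult_zero_right norm_ge_zero)

lemma rkhs_sum: "(\<And>i. i \<in> I \<Longrightarrow> f i \<in> rkhs K) \<Longrightarrow> (\<lambda>z. \<Sum>i\<in>I. f i z) \<in> rkhs K"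
  by (induction I rule: infinite_finite_induct) (simp_all add: rkhs_zero rkhs_add)

text \<open>The coefficients are conjugated because K is conjugate linear in its second slot;
  pairing the function with c then returns \<open>qform F c K\<close>. The truncation meets the
  convention that functions vanish off the ball.\<close>

definition kcomb :: "(complex^'d) set \<Rightarrow> (complex^'d \<Rightarrow> complex) \<Rightarrow> complex^'d \<Rightarrow> complex" where
  "kcomb F c w = (if w \<in> bball then \<Sum>x\<in>F. cnj (c x) * K w x else 0)"

lemma hbound_kcomb:
  assumes F: "finite F" "F \<subseteq> bball"
  shows "hbound (kcomb F c) (knorm F c)"
  unfolding hbound_def
proof (intro allI impI)
  fix G d assume G: "finite G" "G \<subseteq> (bball :: (complex^'d) set)"
  have "(\<Sum>w\<in>G. d w * kcomb F c w) = (\<Sum>w\<in>G. \<Sum>x\<in>F. d w * cnj (c x) * K w x)"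
    using G by (intro sum.cong refl) (auto simp: kcomb_def sum_distrib_left mult.assoc)
  then show "cmod (\<Sum>w\<in>G. d w * kcomb F c w) \<le> knorm F c * knorm G d"
    using psd_on_Cauchy_Schwarz[OF K_psd G F, of d c] by (simp add: knorm_def mult.commute)
qed

lemma kcomb_rkhs: "finite F \<Longrightarrow> F \<subseteq> bball \<Longrightarrow> kcomb F c \<in> rkhs K"
  using hbound_kcomb knorm_nonneg by (intro rkhsI[where C = "knorm F c"]) (auto simp: kcomb_def)

lemma sum_kcomb: "F \<subseteq> bball \<Longrightarrow> (\<Sum>x\<in>F. c x * kcomb F c x) = qform F c K"
  unfolding qform_def by (intro sum.cong refl) (auto simp: kcomb_def sum_distrib_left mult.assoc)

lemma hnorm_eq: "hnorm K f = Inf {C. 0 \<le> C \<and> hbound f C}"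
  unfolding hnorm_def using psd_on_iff_hbound by (metis (no_types, lifting))

lemma hnorm_le: "0 \<le> C \<Longrightarrow> hbound f C \<Longrightarrow> hnorm K f \<le> C"
  unfolding hnorm_eq by (intro cInf_lower bdd_belowI[of _ 0]) auto

lemma hnorm_nonneg: "f \<in> rkhs K \<Longrightarrow> 0 \<le> hnorm K f"
  unfolding hnorm_eq by (intro cInf_greatest) (auto simp: rkhs_iff)

text \<open>The infimum is attained since, for a fixed test vector of nonzero length, the bound is a
  closed condition on the constant.\<close>

lemma hbound_hnorm:
  assumes "f \<in> rkhs K"
  shows "hbound f (hnorm K f)"
  unfolding hbound_def
proof (intro allI impI)
  fix F c assume F: "finite F" "F \<subseteq> (bball :: (complex^'d) set)"
  obtain C where C: "0 \<le> C" "hbound f C"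
    using assms by (auto simp: rkhs_iff)
  show "cmod (\<Sum>x\<in>F. c x * f x) \<le> hnorm K f * knorm F c"
  proof (cases "knorm F c = 0")
    case True
    then show ?thesis using hboundD[OF C(2) F, of c] by simp
  next
    case False
    then have pos: "0 < knorm F c" using knorm_nonneg[OF F, of c] by simp
    have "cmod (\<Sum>x\<in>F. c x * f x) / knorm F c \<le> hnorm K f"
      unfolding hnorm_eq using C hboundD[OF _ F, of f _ c] pos
      by (intro cInf_greatest) (auto simp: divide_le_eq)
    with pos show ?thesis by (simp add: divide_le_eq)
  qed
qed

section \<open>Multipliers and positivity\<close>

lemma mult_algI:
  assumes "\<And>z. z \<notin> bball \<Longrightarrow> \<phi> z = 0" "0 \<le> C"
    and psd: "psd_on bball (\<lambda>z w. (complex_of_real C - \<phi> z * cnj (\<phi> w)) * K z w)"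
  shows "\<phi> \<in> mult_alg K"
  unfolding mult_alg_def
proof (intro CollectI conjI ballI allI impI)
  fix f assume "f \<in> rkhs K"
  then obtain D where D: "0 \<le> D" "hbound f D"
    by (auto simp: rkhs_iff)
  have "psd_on bball (\<lambda>z w. complex_of_real (D^2) * ((complex_of_real C - \<phi> z * cnj (\<phi> w)) * K z w)
     + \<phi> z * (complex_of_real (D^2) * K z w - f z * cnj (f w)) * cnj (\<phi> w))"
    using D psd_on_iff_hbound
    by (intro psd_on_add psd_on_scale[OF psd] psd_on_congruence) (auto simp: less_eq_complex_def simp del: of_real_power)
  then have "psd_on bball (\<lambda>z w. complex_of_real ((sqrt C * D)^2) * K z w - (\<phi> z * f z) * cnj (\<phi> w * f w))"
    by (rule psd_on_cong) (use assms(2) in \<open>simp add: power_mult_distrib algebra_simps flip: of_real_power of_real_mult\<close>)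
  then have "hbound (\<lambda>z. \<phi> z * f z) (sqrt C * D)"
    using assms(2) D by (subst (asm) psd_on_iff_hbound) auto
  then show "(\<lambda>z. \<phi> z * f z) \<in> rkhs K"
    using assms D by (intro rkhsI[where C = "sqrt C * D"]) auto
qed (use assms in auto)

lemma mult_alg_zero_off: "\<phi> \<in> mult_alg K \<Longrightarrow> z \<notin> bball \<Longrightarrow> \<phi> z = 0"
  by (auto simp: mult_alg_def)

lemma mult_alg_rkhs: "\<phi> \<in> mult_alg K \<Longrightarrow> f \<in> rkhs K \<Longrightarrow> (\<lambda>z. \<phi> z * f z) \<in> rkhs K"
  by (auto simp: mult_alg_def)

lemma mult_alg_add: "\<phi> \<in> mult_alg K \<Longrightarrow> \<psi> \<in> mult_alg K \<Longrightarrow> (\<lambda>z. \<phi> z + \<psi> z) \<in> mult_alg K"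
  by (auto simp: mult_alg_def distrib_right rkhs_add)

lemma mult_alg_mult: "\<phi> \<in> mult_alg K \<Longrightarrow> \<psi> \<in> mult_alg K \<Longrightarrow> (\<lambda>z. \<phi> z * \<psi> z) \<in> mult_alg K"
  by (auto simp: mult_alg_def mult.assoc)

lemma mult_alg_scale: "\<phi> \<in> mult_alg K \<Longrightarrow> (\<lambda>z. a * \<phi> z) \<in> mult_alg K"
  by (auto simp: mult_alg_def mult.assoc rkhs_scale)

lemma mult_alg_zero: "(\<lambda>z. 0) \<in> mult_alg K"
  by (auto simp: mult_alg_def rkhs_zero)

lemma mult_alg_sum: "(\<And>i. i \<in> I \<Longrightarrow> \<phi> i \<in> mult_alg K) \<Longrightarrow> (\<lambda>z. \<Sum>i\<in>I. \<phi> i z) \<in> mult_alg K"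
  by (induction I rule: infinite_finite_induct) (simp_all add: mult_alg_zero mult_alg_add)

lemma mult_alg_bconst: "bconst a \<in> mult_alg K"
proof (rule mult_algI[of _ "(cmod a)^2"])
  show "psd_on bball (\<lambda>z w. (complex_of_real ((cmod a)^2) - bconst a z * cnj (bconst a w)) * K z w)"
    by (rule psd_on_cong[OF psd_on_zero]) (simp add: bconst_def complex_norm_square del: of_real_power)
qed (auto simp: bconst_def)

text \<open>The factor \<open>bconst 1\<close> is there for n = 0, where the power would be 1 off
  the ball.\<close>

lemma mult_alg_power: "\<phi> \<in> mult_alg K \<Longrightarrow> (\<lambda>z. bconst 1 z * \<phi> z ^ n) \<in> mult_alg K"
proof (induction n)
  case (Suc n)
  then show ?case
    using mult_alg_mult[OF Suc.prems Suc.IH] by (simp add: mult_ac)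
qed (simp add: mult_alg_bconst)

text \<open>Contractivity of the adjoint, with the adjoint written out: it sends
  \<open>kcomb F c\<close> to the tuple f below. With k = \<open>kcomb F c\<close> and Q bounding
  the squared norm of that tuple, Q is the pairing of \<Phi> f with k, at most sqrt Q times the norm
  of k; cancelling sqrt Q gives the claim.\<close>

lemma row_contraction_psd:
  assumes \<Phi>: "\<And>t. t < s \<Longrightarrow> \<Phi> t \<in> mult_alg K"
    and contr: "\<And>f. (\<forall>t<s. f t \<in> rkhs K) \<Longrightarrow>
       (hnorm K (\<lambda>z. \<Sum>t<s. \<Phi> t z * f t z))^2 \<le> (\<Sum>t<s. (hnorm K (f t))^2)"
  shows "psd_on bball (\<lambda>z w. (1 - (\<Sum>t<s. \<Phi> t z * cnj (\<Phi> t w))) * K z w)"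
proof (rule psd_onI)
  fix F :: "(complex^'d) set" and c
  assume F: "finite F" "F \<subseteq> bball"
  define f where "f t = kcomb F (\<lambda>x. c x * \<Phi> t x)" for t
  define Q where "Q = (\<Sum>t<s. (knorm F (\<lambda>x. c x * \<Phi> t x))^2)"
  let ?g = "\<lambda>z. \<Sum>t<s. \<Phi> t z * f t z"
  have f: "f t \<in> rkhs K" for t
    unfolding f_def by (rule kcomb_rkhs[OF F])
  have g: "?g \<in> rkhs K"
    using \<Phi> f mult_alg_rkhs by (intro rkhs_sum) auto
  have "(hnorm K ?g)^2 \<le> (\<Sum>t<s. (hnorm K (f t))^2)"
    using f by (intro contr) auto
  also have "\<dots> \<le> Q"
    unfolding Q_def f_def using hbound_kcomb[OF F] knorm_nonneg[OF F] hnorm_nonneg[OF kcomb_rkhs[OF F]]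
    by (intro sum_mono power_mono hnorm_le) auto
  finally have g_le: "hnorm K ?g \<le> sqrt Q"
    by (rule real_le_rsqrt)
  have "(\<Sum>x\<in>F. c x * ?g x) = (\<Sum>t<s. \<Sum>x\<in>F. (c x * \<Phi> t x) * f t x)"
    by (subst sum.swap) (simp add: sum_distrib_left mult.assoc)
  also have "\<dots> = complex_of_real Q"
    unfolding f_def Q_def using F by (simp add: sum_kcomb knorm_square)
  finally have "cmod (complex_of_real Q) \<le> hnorm K ?g * knorm F c"
    using hboundD[OF hbound_hnorm[OF g] F, of c] by simp
  also have "\<dots> \<le> sqrt Q * knorm F c"
    using g_le knorm_nonneg[OF F] by (intro mult_right_mono)
  finally have *: "Q \<le> sqrt Q * knorm F c"
    by simp
  have Q0: "0 \<le> Q" by (simp add: Q_def sum_nonneg)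
  have "Q \<le> (knorm F c)^2"
  proof (cases "Q = 0")
    case False
    with Q0 have "0 < sqrt Q" by simp
    moreover have "sqrt Q * sqrt Q \<le> sqrt Q * knorm F c" using * Q0 by simp
    ultimately have "sqrt Q \<le> knorm F c" by (simp only: mult_le_cancel_left_pos)
    then show ?thesis using Q0 by (rule_tac sqrt_le_D)
  qed simp
  moreover have "qform F c (\<lambda>z w. (1 - (\<Sum>t<s. \<Phi> t z * cnj (\<Phi> t w))) * K z w)
     = complex_of_real ((knorm F c)^2 - Q)"
  proof -
    have "qform F c (\<lambda>z w. (1 - (\<Sum>t<s. \<Phi> t z * cnj (\<Phi> t w))) * K z w)
       = qform F c (\<lambda>z w. K z w - (\<Sum>t<s. \<Phi> t z * K z w * cnj (\<Phi> t w)))"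
      by (intro qform_cong) (simp_all add: algebra_simps sum_distrib_left)
    then show ?thesis
      unfolding qform_diff qform_sum qform_congruence Q_def using F by (simp add: knorm_square)
  qed
  ultimately show "0 \<le> qform F c (\<lambda>z w. (1 - (\<Sum>t<s. \<Phi> t z * cnj (\<Phi> t w))) * K z w)"
    by (simp add: less_eq_complex_def)
qed

end

lemma not_psd_onE:
  assumes "\<not> psd_on S L"
  obtains F c where "finite F" "F \<subseteq> S" "\<not> 0 \<le> qform F c L"
  using assms by (auto simp: psd_on_iff)

context pos_kernel
begin

text \<open>Closed graph theorem for multipliers, by a gliding hump: if the multiplication operator were
  unbounded, signed multiples of normalised bad vectors would sum to an element of the space
  whose product with the multiplier has infinite norm.\<close>
lemma mult_alg_bounded:
  assumes \<phi>: "\<phi> \<in> mult_alg K"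
  shows "\<exists>C\<ge>0. psd_on bball (\<lambda>z w. (complex_of_real C - \<phi> z * cnj (\<phi> w)) * K z w)"
proof (rule ccontr)
  assume unb: "\<not> ?thesis"
  have "\<exists>F c. finite F \<and> F \<subseteq> bball \<and> 4^n * knorm F c < knorm F (\<lambda>x. c x * \<phi> x)" for n :: nat
  proof -
    have "\<not> psd_on bball (\<lambda>z w. (complex_of_real (16^n) - \<phi> z * cnj (\<phi> w)) * K z w)"
    proof
      assume "psd_on bball (\<lambda>z w. (complex_of_real (16^n) - \<phi> z * cnj (\<phi> w)) * K z w)"
      then have "\<exists>C\<ge>0. psd_on bball (\<lambda>z w. (complex_of_real C - \<phi> z * cnj (\<phi> w)) * K z w)"
        by (intro exI[of _ "16^n"]) simp
      with unb show False by contradiction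
    qed
    then obtain F c where F: "finite F" "F \<subseteq> bball"
      and neg: "\<not> 0 \<le> qform F c (\<lambda>z w. (complex_of_real (16^n) - \<phi> z * cnj (\<phi> w)) * K z w)"
      by (rule not_psd_onE)
    have "qform F c (\<lambda>z w. (complex_of_real (16^n) - \<phi> z * cnj (\<phi> w)) * K z w)
      = qform F c (\<lambda>z w. complex_of_real (16^n) * K z w - \<phi> z * K z w * cnj (\<phi> w))"
      by (intro qform_cong) (simp_all add: algebra_simps)
    also have "\<dots> = complex_of_real (16^n * (knorm F c)^2 - (knorm F (\<lambda>x. c x * \<phi> x))^2)"
      unfolding qform_diff qform_scale qform_congruence using F by (simp add: knorm_square)
    finally have "16^n * (knorm F c)^2 < (knorm F (\<lambda>x. c x * \<phi> x))^2"
      using neg by (simp add: less_eq_complex_def del: of_real_diff)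
    also have "16^n * (knorm F c)^2 = (4^n * knorm F c)^2"
      by (simp add: power_mult_distrib power_even_eq[of "4::real", symmetric] power_mult)
    finally have "4^n * knorm F c < knorm F (\<lambda>x. c x * \<phi> x)"
      using knorm_nonneg[OF F] by (rule_tac power_less_imp_less_base) auto
    with F show ?thesis by blast
  qed
  then obtain F c where F: "\<And>n. finite (F n)" "\<And>n. F n \<subseteq> bball"
    and big: "\<And>n. 4^n * knorm (F n) (c n) < knorm (F n) (\<lambda>x. c n x * \<phi> x)"
    by metis
  define A where "A n = knorm (F n) (\<lambda>x. c n x * \<phi> x)" for n
  define y where "y n = kcomb (F n) (\<lambda>x. c n x * \<phi> x)" for n
  \<comment> \<open>The pairing of f with the multiplied bad vector, hence at most the norm of f
    times \<open>A n\<close>. It is also the pairing of the product \<phi> f with the original bad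
    vector, which is shorter by a factor \<open>4^n\<close>; this is where the contradiction will
    come from.\<close>
  define L where "L n f = (\<Sum>x\<in>F n. c n x * \<phi> x * f x)" for n and f :: "complex^'d \<Rightarrow> complex"
  have A: "0 < A n" for n
    unfolding A_def using big[of n] knorm_nonneg[OF F, of n "c n"]
    by (meson le_less_trans mult_nonneg_nonneg zero_le_numeral zero_le_power)
  have Ly: "L n (y n) = complex_of_real ((A n)^2)" for n
    unfolding L_def y_def A_def using F by (simp add: sum_kcomb knorm_square)
  have L_add: "L n (\<lambda>z. f z + a * g z) = L n f + a * L n g" for n f g a
    unfolding L_def by (simp add: distrib_left sum.distrib sum_distrib_left mult_ac)
  have L_bound: "cmod (L n f) \<le> D * A n" if "hbound f D" for n f D
    unfolding L_def A_def by (rule hboundD[OF that F])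
  define P where "P n f \<longleftrightarrow> (\<forall>z. z \<notin> bball \<longrightarrow> f z = 0) \<and> (n = 0 \<longrightarrow> f = (\<lambda>z. 0))"
    for n :: nat and f :: "complex^'d \<Rightarrow> complex"
  define R where "R n f g \<longleftrightarrow> hbound (\<lambda>z. g z - f z) ((1/3)^n) \<and> (1/3)^n * A n \<le> cmod (L n g)" for n f g
  have "\<exists>s. \<forall>n. P n (s n) \<and> R n (s n) (s (Suc n))"
  proof (rule dependent_nat_choice)
    show "\<exists>f. P 0 f" by (auto simp: P_def)
  next
    fix f n assume "P n f"
    \<comment> \<open>This makes the increment e \<open>y n\<close> of norm at most (1/3)^n. Adding
      it with either sign gives two values of \<open>L n\<close> at distance 2 (1/3)^n
      \<open>A n\<close>, so one of them has modulus at least half of that.\<close>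
    define e where "e = complex_of_real ((1/3)^n / A n)"
    have Le: "e * L n (y n) = complex_of_real ((1/3)^n * A n)"
      unfolding Ly e_def of_real_mult[symmetric] using A[of n] by (simp add: power2_eq_square)
    have step: "hbound (\<lambda>z. a * y n z) ((1/3)^n)" if "cmod a = (1/3)^n / A n" for a
      using hbound_scale[OF hbound_kcomb[OF F], of a n "\<lambda>x. c n x * \<phi> x"] that A[of n]
      by (simp add: y_def A_def)
    have "2 * ((1/3)^n * A n) = cmod ((L n f + e * L n (y n)) - (L n f + (- e) * L n (y n)))"
    proof -
      have "(L n f + e * L n (y n)) - (L n f + (- e) * L n (y n)) = 2 * (e * L n (y n))"
        by (simp add: algebra_simps)
      then show ?thesis
        unfolding Le using A[of n] by (simp add: norm_mult norm_power norm_divide)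
    qed
    also have "\<dots> \<le> cmod (L n f + e * L n (y n)) + cmod (L n f + (- e) * L n (y n))"
      by (rule norm_triangle_ineq4)
    finally have "\<exists>a\<in>{e, - e}. (1/3)^n * A n \<le> cmod (L n f + a * L n (y n))"
      by auto
    then obtain a where a: "a \<in> {e, - e}" "(1/3)^n * A n \<le> cmod (L n f + a * L n (y n))"
      by blast
    have "cmod a = (1/3)^n / A n"
      using a(1) A[of n] by (auto simp: e_def norm_divide norm_power)
    then have "P (Suc n) (\<lambda>z. f z + a * y n z) \<and> R n f (\<lambda>z. f z + a * y n z)"
      using \<open>P n f\<close> a(2) step[of a] L_add[of n f a "y n"] by (simp add: P_def R_def y_def kcomb_def)
    then show "\<exists>g. P (Suc n) g \<and> R n f g" by blast
  qed
  then obtain s where sP: "\<And>n. P n (s n)" and sR: "\<And>n. R n (s n) (s (Suc n))"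
    by blast
  have diff: "hbound (\<lambda>z. s (n + k) z - s n z) (3/2 * ((1/3)^n - (1/3)^(n + k)))" for n k
  proof (induction k)
    case 0
    then show ?case using hbound_zero by simp
  next
    case (Suc k)
    have "hbound (\<lambda>z. (s (n + k) z - s n z) + (s (Suc (n + k)) z - s (n + k) z))
       (3/2 * ((1/3)^n - (1/3)^(n + k)) + (1/3)^(n + k))"
      using sR[of "n + k"] by (intro hbound_add Suc) (simp add: R_def)
    then show ?case by (simp add: algebra_simps)
  qed
  have conv: "convergent (\<lambda>n. s n x)" if "x \<in> bball" for x
  proof -
    have bd: "cmod (s (Suc n) x - s n x) \<le> (1/3)^n * knorm {x} (\<lambda>_. 1)" for n
      using sR[of n] hboundD[of "\<lambda>z. s (Suc n) z - s n z" "(1/3)^n" "{x}" "\<lambda>_. 1"] that by (simp add: R_def)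
    have "summable (\<lambda>n. (1/3)^n * knorm {x} (\<lambda>_. 1))"
      by (intro summable_mult2 summable_geometric) auto
    then have "summable (\<lambda>n. s (Suc n) x - s n x)"
      by (rule summable_comparison_test'[where N = 0]) (rule bd)
    then show ?thesis
      unfolding summable_iff_convergent sum_lessThan_telescope[of "\<lambda>n. s n x"] convergent_diff_const_right_iff .
  qed
  define f where "f x = lim (\<lambda>n. s n x)" for x
  have f: "(\<lambda>n. s n x) \<longlonglongrightarrow> f x" if "x \<in> bball" for x
    unfolding f_def using conv[OF that] by (simp add: convergent_LIMSEQ_iff)
  have f_off: "f x = 0" if "x \<notin> bball" for x
    using sP that by (simp add: f_def P_def)
  have tail: "hbound (\<lambda>z. f z - s n z) (3/2 * (1/3)^n)" for n
  proof (rule hbound_limit)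
    show "hbound (\<lambda>z. s (n + k) z - s n z) (3/2 * (1/3)^n)" for k
      by (rule hbound_mono[OF diff]) simp
    show "(\<lambda>k. s (n + k) x - s n x) \<longlonglongrightarrow> f x - s n x" if "x \<in> bball" for x
      using LIMSEQ_ignore_initial_segment[OF f[OF that], of n]
      by (intro tendsto_diff tendsto_const) (simp add: add.commute)
  qed
  have "f \<in> rkhs K"
    using tail[of 0] sP[of 0] f_off by (intro rkhsI[of f "3/2"]) (auto simp: P_def)
  then have "(\<lambda>z. \<phi> z * f z) \<in> rkhs K"
    by (rule mult_alg_rkhs[OF \<phi>])
  then obtain D where D: "0 \<le> D" "hbound (\<lambda>z. \<phi> z * f z) D"
    by (auto simp: rkhs_iff)
  \<comment> \<open>All increments after step n together have norm at most (1/2)(1/3)^n, so half of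
    the gain at step n survives in f. As 4 exceeds 3, the lower bound outgrows the norm of the
    product.\<close>
  have "(4/3)^n \<le> 2 * D" for n
  proof -
    have "L n (\<lambda>z. f z + (-1) * s (Suc n) z) = L n f + (-1) * L n (s (Suc n))"
      by (rule L_add)
    then have "cmod (L n (s (Suc n)) - L n f) \<le> 1/2 * (1/3)^n * A n"
      using L_bound[OF tail[of "Suc n"], of n] by (simp add: norm_minus_commute)
    moreover have "(1/3)^n * A n \<le> cmod (L n (s (Suc n)))"
      using sR[of n] by (simp add: R_def)
    ultimately have "1/2 * (1/3)^n * A n \<le> cmod (L n f)"
      using norm_triangle_ineq2[of "L n (s (Suc n))" "L n f"] by linarith
    also have "cmod (L n f) \<le> D * knorm (F n) (c n)"
      unfolding L_def using hboundD[OF D(2) F(1)[of n] F(2)[of n], of "c n"] by (simp add: mult.assoc)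
    also have "\<dots> \<le> D * (A n / 4^n)"
      using big[of n] D(1) by (intro mult_left_mono) (simp_all add: A_def field_simps)
    finally have "1/2 * (1/3)^n * A n \<le> (D / 4^n) * A n"
      by simp
    then have "1/2 * (1/3)^n \<le> D / 4^n"
      using A[of n] by (simp only: mult_le_cancel_right_pos)
    then show ?thesis
      by (simp add: field_simps power_divide)
  qed
  moreover obtain n where "2 * D < (4/3)^n"
    using real_arch_pow[of "4/3" "2 * D"] by auto
  ultimately show False
    by (meson not_less)
qed

end

section \<open>Factorisation through a complete Pick kernel\<close>

lemma psd_on_cinner: "psd_on S (\<lambda>x y. cinner (f x) (f y))"
  unfolding cinner_def by (intro psd_on_sum psd_on_rank_one)

text \<open>For a kernel without zeros, B x y is 1 - K(x,p) K(p,y) / (K(x,y) K(p,p)).\<close>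
definition complete_pick_kernel :: "(complex^'d \<Rightarrow> complex^'d \<Rightarrow> complex) \<Rightarrow> bool" where
  "complete_pick_kernel K \<longleftrightarrow> (\<forall>p\<in>bball. \<exists>B. psd_on bball B \<and>
     (\<forall>x\<in>bball. \<forall>y\<in>bball. schur_compl K p x y = B x y * K x y))"

text \<open>A triple (z, v, g) prescribes the value g for the contractive row multiplier at the point z in the
  direction v.\<close>
fun interp_kernel :: "(complex^'d \<Rightarrow> complex^'d \<Rightarrow> complex) \<Rightarrow> (complex^'d) \<times> (complex^'m) \<times> complex
    \<Rightarrow> (complex^'d) \<times> (complex^'m) \<times> complex \<Rightarrow> complex" where
  "interp_kernel K (z, v, g) (z', v', g') = (cinner v v' - g * cnj g') * K z z'"

context pos_kernel
begin

text \<open>The interpolation kernel is split as N - \<rho> \<rho>^*, with K replaced by its Schur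
  complement at z in the value part of N. That complement vanishes at z, so N does not involve the
  unknown value, which enters only through \<rho> and can be found by extending a functional. For
  positivity, N is B times the interpolation kernel on T, extended by zero rows, plus a product of
  positive kernels.\<close>

lemma interp_kernel_extend:
  fixes T :: "((complex^'d) \<times> (complex^'m) \<times> complex) set" and v :: "complex^'m"
  assumes cp: "complete_pick_kernel K" and Kz: "K z z \<noteq> 0"
    and T: "fst ` T \<subseteq> bball" and psd: "psd_on T (interp_kernel K)" and z: "z \<in> bball"
  shows "\<exists>g. psd_on (insert (z, v, g) T) (interp_kernel K)"
proof (cases "(z, v, 0) \<in> T")
  case True
  then show ?thesis using psd by (metis insert_absorb)
next
  case False
  \<comment> \<open>The value 0 is a placeholder. If this triple already lies in T there is nothing
    to prove, which is why that case was treated separately.\<close>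
  define e where "e = (z, v, 0 :: complex)"
  define sk where "sk = complex_of_real (sqrt (Re (K z z)))"
  have "0 \<le> K z z" using psd_on_diag[OF K_psd z] .
  then have sk: "sk * sk = K z z" "cnj sk = sk"
    by (auto simp: sk_def less_eq_complex_def complex_eq_iff)
  then have sk0: "sk \<noteq> 0" using Kz by auto
  have herm: "K z x = cnj (K x z)" if "x \<in> bball" for x
    using psd_on_hermitian[OF K_psd that z] .
  obtain B where B: "psd_on bball B"
    and BK: "\<And>x y. x \<in> bball \<Longrightarrow> y \<in> bball \<Longrightarrow> schur_compl K z x y = B x y * K x y"
    using cp z by (auto simp: complete_pick_kernel_def)
  define pt where "pt = (fst :: (complex^'d) \<times> (complex^'m) \<times> complex \<Rightarrow> complex^'d)"
  define dir where "dir x = fst (snd x)" for x :: "(complex^'d) \<times> (complex^'m) \<times> complex"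
  define vl where "vl x = snd (snd x)" for x :: "(complex^'d) \<times> (complex^'m) \<times> complex"
  have ik: "interp_kernel K x y = (cinner (dir x) (dir y) - vl x * cnj (vl y)) * K (pt x) (pt y)" for x y
    by (cases x; cases y) (simp add: pt_def dir_def vl_def)
  have e: "pt e = z" "dir e = v" "vl e = 0"
    by (simp_all add: e_def pt_def dir_def vl_def)
  have ptT: "pt x \<in> bball" if "x \<in> insert e T" for x
    using that T z e by (auto simp: pt_def)
  define N where "N x y = cinner (dir x) (dir y) * K (pt x) (pt y) - vl x * cnj (vl y) * schur_compl K z (pt x) (pt y)" for x y
  define \<rho> where "\<rho> x = vl x * K (pt x) z / sk" for x
  have schur0: "schur_compl K z x z = 0" "schur_compl K z z x = 0" if "x \<in> bball" for x
    using schur_compl_zero[OF K_psd that z] by auto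
  have rank: "a * K x z / sk * cnj (b * K y z / sk) = a * cnj b * (K x z * K z y / K z z)" if "y \<in> bball" for a b x y
    using herm[OF that] sk sk0 by (simp flip: sk(1))
  have N_psd: "psd_on (insert e T) N"
  proof -
    have "psd_on T (\<lambda>x y. B (pt x) (pt y) * interp_kernel K x y)"
      using ptT by (intro psd_on_mult psd psd_on_pullback[OF B]) auto
    then have "psd_on T (\<lambda>x y. (cinner (dir x) (dir y) - vl x * cnj (vl y)) * schur_compl K z (pt x) (pt y))"
      by (rule psd_on_cong) (use ptT BK in \<open>simp add: ik\<close>)
    then have 1: "psd_on (insert e T) (\<lambda>x y. (cinner (dir x) (dir y) - vl x * cnj (vl y)) * schur_compl K z (pt x) (pt y))"
      by (rule psd_on_insert_zero_row) (use ptT schur0 e in auto)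
    have 2: "psd_on (insert e T) (\<lambda>x y. cinner (dir x) (dir y) * ((K (pt x) z / sk) * cnj (K (pt y) z / sk)))"
      by (intro psd_on_mult psd_on_cinner psd_on_rank_one)
    show ?thesis
    proof (rule psd_on_cong[OF psd_on_add[OF 1 2]])
      fix x y assume "x \<in> insert e T" "y \<in> insert e T"
      then show "N x y = (cinner (dir x) (dir y) - vl x * cnj (vl y)) * schur_compl K z (pt x) (pt y)
        + cinner (dir x) (dir y) * ((K (pt x) z / sk) * cnj (K (pt y) z / sk))"
        using rank[of "pt y" 1 "pt x" 1] ptT by (simp add: N_def schur_compl_def algebra_simps diff_divide_distrib)
    qed
  qed
  have Q_eq: "interp_kernel K x y = N x y - \<rho> x * cnj (\<rho> y)" if "x \<in> T" "y \<in> T" for x y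
    using rank[of "pt y" "vl x" "pt x" "vl y"] ptT that
    by (simp add: ik N_def \<rho>_def schur_compl_def algebra_simps)
  have "psd_on T (\<lambda>x y. N x y - \<rho> x * cnj (\<rho> y))"
    by (rule psd_on_cong[OF psd]) (use Q_eq in simp)
  moreover have "e \<notin> T" using False by (simp add: e_def)
  ultimately obtain r where r: "psd_on (insert e T) (\<lambda>x y. N x y - (\<rho>(e := r)) x * cnj ((\<rho>(e := r)) y))"
    using psd_on_extend_functional[OF _ N_psd] by blast
  define g where "g = r / sk"
  \<comment> \<open>Replaces the triple carrying the value g by the placeholder e, unless it was
    already in T. The value g = r / \<open>sk\<close> makes g \<open>K z z\<close> /
    \<open>sk\<close> equal to r.\<close>
  define h where "h x = (if x \<in> T then x else e)" for x
  have "psd_on (insert (z, v, g) T)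
      (\<lambda>x y. N (h x) (h y) - (\<rho>(e := r)) (h x) * cnj ((\<rho>(e := r)) (h y)))"
    by (rule psd_on_pullback[OF r]) (auto simp: h_def)
  then have "psd_on (insert (z, v, g) T) (interp_kernel K)"
  proof (rule psd_on_cong)
    fix x y assume xy: "x \<in> insert (z, v, g) T" "y \<in> insert (z, v, g) T"
    have pts: "pt x \<in> bball" "pt y \<in> bball"
      using xy T z by (auto simp: pt_def image_subset_iff)
    have hx: "dir (h u) = dir u" "pt (h u) = pt u" "(\<rho>(e := r)) (h u) = vl u * K (pt u) z / sk"
      "vl (h u) * w * schur_compl K z (pt u) s = vl u * w * schur_compl K z (pt u) s"
      "w * cnj (vl (h u)) * schur_compl K z s (pt u) = w * cnj (vl u) * schur_compl K z s (pt u)"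
      if "u \<in> insert (z, v, g) T" "s \<in> bball" for u w s
    proof -
      have new: "dir u = v" "pt u = z" "vl u = g" "h u = e" if "u \<notin> T"
        using that \<open>u \<in> insert (z, v, g) T\<close> by (auto simp: h_def dir_def pt_def vl_def)
      have gsk: "g * K z z / sk = r"
        using sk0 by (simp add: g_def flip: sk(1))
      show "dir (h u) = dir u" "pt (h u) = pt u"
        using new e by (auto simp: h_def)
      show "(\<rho>(e := r)) (h u) = vl u * K (pt u) z / sk"
      proof (cases "u \<in> T")
        case True
        with \<open>e \<notin> T\<close> have "u \<noteq> e" by blast
        with True show ?thesis by (simp add: h_def \<rho>_def)
      qed (simp add: new gsk)
      show "vl (h u) * w * schur_compl K z (pt u) s = vl u * w * schur_compl K z (pt u) s"
        "w * cnj (vl (h u)) * schur_compl K z s (pt u) = w * cnj (vl u) * schur_compl K z s (pt u)"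
        using schur0[OF that(2)] by (cases "u \<in> T"; simp add: h_def new)+
    qed
    have "N (h x) (h y) = cinner (dir x) (dir y) * K (pt x) (pt y) - vl x * cnj (vl y) * schur_compl K z (pt x) (pt y)"
      unfolding N_def hx(1,2)[OF xy(1) z] hx(1,2)[OF xy(2) z]
      by (simp only: hx(4)[OF xy(1) pts(2)] hx(5)[OF xy(2) pts(1)])
    then show "interp_kernel K x y = N (h x) (h y) - (\<rho>(e := r)) (h x) * cnj ((\<rho>(e := r)) (h y))"
      unfolding hx(3)[OF xy(1) z] hx(3)[OF xy(2) z] rank[OF pts(2)]
      by (simp add: ik schur_compl_def algebra_simps)
  qed
  then show ?thesis by blast
qed

text \<open>A maximal set of prescriptions contains a value for every point and every direction. The
  values in the axis directions are the factors, and positivity forces the value to be linear in the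
  direction, which is the required identity.\<close>

theorem leech_factorisation:
  fixes U :: "complex^'d \<Rightarrow> complex^'m"
  assumes cp: "complete_pick_kernel K" and K0: "\<And>z. z \<in> bball \<Longrightarrow> K z z \<noteq> 0"
    and psd: "psd_on bball (\<lambda>z w. (cinner (U z) (U w) - h z * cnj (h w)) * K z w)"
  shows "\<exists>g. (\<forall>j. g j \<in> mult_alg K) \<and> (\<forall>z\<in>bball. h z = (\<Sum>j\<in>UNIV. U z $ j * g j z))"
proof -
  define T0 where "T0 = (\<lambda>z. (z, U z, h z)) ` bball"
  define \<A> where "\<A> = {T. T0 \<subseteq> T \<and> fst ` T \<subseteq> bball \<and> psd_on T (interp_kernel K)}"
  have "psd_on T0 (\<lambda>x y. (cinner (U (fst x)) (U (fst y)) - h (fst x) * cnj (h (fst y))) * K (fst x) (fst y))"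
    by (rule psd_on_pullback[OF psd]) (auto simp: T0_def)
  then have "psd_on T0 (interp_kernel K)"
    by (rule psd_on_cong) (auto simp: T0_def)
  then have "T0 \<in> \<A>"
    by (auto simp: \<A>_def T0_def)
  then have "\<exists>M\<in>\<A>. \<forall>X\<in>\<A>. M \<subseteq> X \<longrightarrow> X = M"
  proof (intro subset_Zorn_nonempty)
    fix \<C> assume ne: "\<C> \<noteq> {}" and chain: "subset.chain \<A> \<C>"
    then have sub: "\<C> \<subseteq> \<A>" by (simp add: subset.chain_def)
    have "psd_on (\<Union>\<C>) (interp_kernel K)"
    proof (rule psd_onI)
      fix F c assume F: "finite F" "F \<subseteq> \<Union>\<C>"
      then obtain X where X: "X \<in> \<C>" "F \<subseteq> X"
        using finite_subset_Union_chain[OF F ne chain] by blast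
      with sub have "psd_on X (interp_kernel K)" by (auto simp: \<A>_def)
      then show "0 \<le> qform F c (interp_kernel K)"
        by (rule psd_onD) (use F X in auto)
    qed
    then show "\<Union>\<C> \<in> \<A>"
      using sub ne by (fastforce simp: \<A>_def)
  qed auto
  then obtain M where M: "M \<in> \<A>" and max: "\<And>X. X \<in> \<A> \<Longrightarrow> M \<subseteq> X \<Longrightarrow> X = M"
    by blast
  have M': "T0 \<subseteq> M" "fst ` M \<subseteq> bball" "psd_on M (interp_kernel K)"
    using M by (auto simp: \<A>_def)
  have total: "\<exists>g. (z, v, g) \<in> M" if z: "z \<in> bball" for z v
  proof -
    obtain g where "psd_on (insert (z, v, g) M) (interp_kernel K)"
      using interp_kernel_extend[OF cp K0[OF z] M'(2,3) z] by blast
    then have "insert (z, v, g) M \<in> \<A>"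
      using M' z by (auto simp: \<A>_def)
    then show ?thesis
      using max[of "insert (z, v, g) M"] by blast
  qed
  define g where "g j z = (if z \<in> bball then SOME y. (z, axis j 1, y) \<in> M else 0)" for j z
  have g: "(z, axis j 1, g j z) \<in> M" if "z \<in> bball" for j z
    using someI_ex[OF total[OF that, of "axis j 1"]] that by (simp add: g_def)
  have axis: "cinner (axis j 1) (axis j 1 :: complex^'m) = 1" for j
    by (simp add: cinner_def axis_def if_distrib cong: if_cong)
  have "g j \<in> mult_alg K" for j
  proof (rule mult_algI[of _ 1])
    have "psd_on bball (\<lambda>z w. interp_kernel K (z, axis j 1, g j z) (w, axis j 1, g j w))"
      by (rule psd_on_pullback[OF M'(3)]) (use g in auto)
    then show "psd_on bball (\<lambda>z w. (complex_of_real 1 - g j z * cnj (g j w)) * K z w)"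
      by (simp add: axis)
  qed (auto simp: g_def)
  moreover have "h z = (\<Sum>j\<in>UNIV. U z $ j * g j z)" if z: "z \<in> bball" for z
  proof -
    \<comment> \<open>At the fixed point z, \<open>None\<close> stands for the direction
      \<open>U z\<close> and \<open>Some j\<close> for the j-th axis. The coefficients c express the
      linear relation between these directions, so the direction part of the form cancels and only
      minus a square, that of the same relation between the values, is left.\<close>
    define p where "p a = (case a of None \<Rightarrow> (z, U z, h z) | Some j \<Rightarrow> (z, axis j 1, g j z))" for a
    define v where "v a = (case a of None \<Rightarrow> U z | Some j \<Rightarrow> axis j 1)" for a
    define y where "y a = (case a of None \<Rightarrow> h z | Some j \<Rightarrow> g j z)" for a
    define c where "c a = (case a of None \<Rightarrow> 1 | Some j \<Rightarrow> - (U z $ j))" for a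
    have opt: "(\<Sum>a\<in>UNIV. f a) = f None + (\<Sum>j\<in>UNIV. f (Some j))" for f :: "'m option \<Rightarrow> complex"
      by (simp add: UNIV_option_conv sum.reindex)
    have comb: "(\<Sum>a\<in>UNIV. c a * v a $ i) = 0" for i
      unfolding opt by (simp add: c_def v_def axis_def sum_negf if_distrib cong: if_cong)
    have "psd_on UNIV (\<lambda>a b. interp_kernel K (p a) (p b))"
      by (rule psd_on_pullback[OF M'(3)]) (use g[OF z] M'(1) z in \<open>auto simp: p_def T0_def split: option.split\<close>)
    then have "0 \<le> qform UNIV c (\<lambda>a b. interp_kernel K (p a) (p b))"
      by (rule psd_onD) auto
    also have "(\<lambda>a b. interp_kernel K (p a) (p b)) = (\<lambda>a b. K z z * ((\<Sum>i\<in>UNIV. v a $ i * cnj (v b $ i)) - y a * cnj (y b)))"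
      by (intro ext) (auto simp: p_def v_def y_def cinner_def mult.commute split: option.split)
    also have "qform UNIV c \<dots> = K z z * ((\<Sum>i\<in>UNIV. complex_of_real ((cmod (\<Sum>a\<in>UNIV. c a * v a $ i))^2))
         - complex_of_real ((cmod (\<Sum>a\<in>UNIV. c a * y a))^2))"
      unfolding qform_scale qform_diff qform_sum qform_rank_one ..
    finally have "0 \<le> - (K z z * complex_of_real ((cmod (\<Sum>a\<in>UNIV. c a * y a))^2))"
      by (simp add: comb)
    moreover have "0 \<le> K z z" using psd_on_diag[OF K_psd z] .
    moreover have "0 < Re (K z z)"
      using K0[OF z] calculation(2) by (auto simp: less_eq_complex_def complex_eq_iff order_less_le)
    ultimately have "(\<Sum>a\<in>UNIV. c a * y a) = 0"
      by (simp add: less_eq_complex_def mult_le_0_iff)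
    then show ?thesis
      unfolding opt by (simp add: c_def y_def sum_negf)
  qed
  ultimately show ?thesis by blast
qed

end

section \<open>The McCullough--Quiggin theorem\<close>

context pos_kernel
begin

text \<open>The interpolation property for a single row, with its contractivity restated as
  positivity on the whole ball.\<close>

lemma cnp_row_interpolation:
  assumes cnp: "cnp K" and P: "finite P" "P \<subseteq> bball" and s: "0 < (s::nat)"
    and psd: "psd_on P (\<lambda>x y. (1 - (\<Sum>t<s. W x t * cnj (W y t))) * K x y)"
  shows "\<exists>\<Phi>. psd_on bball (\<lambda>x y. (1 - (\<Sum>t<s. \<Phi> t x * cnj (\<Phi> t y))) * K x y)
    \<and> (\<forall>x\<in>P. \<forall>t<s. \<Phi> t x = W x t)"
proof -
  obtain h where h: "bij_betw h {..<card P} P"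
    using ex_bij_betw_nat_finite[OF P(1)] by (auto simp: atLeast0LessThan)
  then have hP: "h i \<in> P" if "i < card P" for i
    using that by (auto dest: bij_betwE)
  have "\<exists>\<Phi>. (\<forall>p<(1::nat). \<forall>t<s. \<Phi> p t \<in> mult_alg K) \<and>
      (\<forall>f. (\<forall>t<s. f t \<in> rkhs K) \<longrightarrow>
        (\<Sum>p<1. (hnorm K (\<lambda>z. \<Sum>t<s. \<Phi> p t z * f t z))^2) \<le> (\<Sum>t<s. (hnorm K (f t))^2)) \<and>
      (\<forall>i<card P. \<forall>p<1. \<forall>t<s. \<Phi> p t (h i) = W (h i) t)"
  proof (rule cnp[unfolded cnp_def, rule_format], intro conjI allI)
    show "i < card P \<longrightarrow> h i \<in> bball" for i
      using hP P(2) by auto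
    \<comment> \<open>\<open>cnp\<close> conjugates the first coefficient and \<open>psd_on\<close>
      the second, hence the conjugated test vector.\<close>
    show "let q = (\<Sum>i<card P. \<Sum>j<card P. \<Sum>p<1. \<Sum>p'<1. cnj (c i p) * c j p' *
        ((if p = p' then 1 else 0) - (\<Sum>t<s. W (h i) t * cnj (W (h j) t))) * K (h i) (h j))
      in Im q = 0 \<and> 0 \<le> Re q" for c :: "nat \<Rightarrow> nat \<Rightarrow> complex"
      using psd[unfolded psd_on_def, rule_format, of "card P" h "\<lambda>i. cnj (c i 0)"] hP
      by (simp add: mult.assoc)
  qed (use s in auto)
  then obtain \<Phi> where \<Phi>: "\<forall>p<(1::nat). \<forall>t<s. \<Phi> p t \<in> mult_alg K"
    "\<forall>f. (\<forall>t<s. f t \<in> rkhs K) \<longrightarrow>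
        (\<Sum>p<1. (hnorm K (\<lambda>z. \<Sum>t<s. \<Phi> p t z * f t z))^2) \<le> (\<Sum>t<s. (hnorm K (f t))^2)"
    "\<forall>i<card P. \<forall>p<1. \<forall>t<s. \<Phi> p t (h i) = W (h i) t"
    by blast
  have "psd_on bball (\<lambda>x y. (1 - (\<Sum>t<s. \<Phi> 0 t x * cnj (\<Phi> 0 t y))) * K x y)"
    by (rule row_contraction_psd) (use \<Phi>(1,2) in auto)
  moreover have "\<Phi> 0 t x = W x t" if "x \<in> P" "t < s" for x t
  proof -
    have "x \<in> h ` {..<card P}"
      using that(1) bij_betw_imp_surj_on[OF h] by simp
    then obtain i where "i < card P" "h i = x"
      by auto
    with \<Phi>(3) that(2) show ?thesis by auto
  qed
  ultimately show ?thesis by blast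
qed

text \<open>If \<open>K x p\<close> were zero, the Pick matrix for the values 1 at x and 0 at p
  would be diagonal and nonnegative, so a contractive multiplier would take these values. Its Schur
  complement form at b has a zero diagonal entry at x but the entry -1 at (x, p). The form with K
  itself would give no contradiction, since its entry at (x, p) is zero by assumption.\<close>

lemma cnp_kernel_nonzero:
  assumes cnp: "cnp K" and diag: "\<And>x. x \<in> bball \<Longrightarrow> K x x \<noteq> 0"
    and b: "b \<in> bball" "\<And>x. x \<in> bball \<Longrightarrow> K x b = 1" "\<And>x. x \<in> bball \<Longrightarrow> K b x = 1"
    and xp: "x \<in> bball" "p \<in> bball"
  shows "K x p \<noteq> 0"
proof
  assume zero: "K x p = 0"
  then have ne: "x \<noteq> p" using diag xp by auto
  have zero': "K p x = 0"
    using psd_on_hermitian[OF K_psd xp] zero by simp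
  define W where "W y = (\<lambda>t::nat. if y = x then 1 else 0 :: complex)" for y
  have "psd_on {x, p} (\<lambda>u v. K p p * ((if u = p then 1 else 0) * cnj (if v = p then 1 else 0)))"
    using psd_on_diag[OF K_psd xp(2)] by (intro psd_on_scale psd_on_rank_one)
  then have "psd_on {x, p} (\<lambda>u v. (1 - (\<Sum>t<1. W u t * cnj (W v t))) * K u v)"
    by (rule psd_on_cong) (use ne zero zero' in \<open>auto simp: W_def\<close>)
  then obtain \<Phi> where \<Phi>: "psd_on bball (\<lambda>x y. (1 - (\<Sum>t<1. \<Phi> t x * cnj (\<Phi> t y))) * K x y)"
    "\<forall>u\<in>{x, p}. \<forall>t<1. \<Phi> t u = W u t"
    using cnp_row_interpolation[OF cnp, of "{x, p}" 1 W] xp by auto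
  have "psd_on bball (\<lambda>x y. \<Sum>t<(1::nat). \<Phi> t x * cnj (\<Phi> t y))"
    by (intro psd_on_sum psd_on_rank_one)
  from psd_on_schur_compl_mult[OF K_psd b(1) this \<Phi>(1)]
  have "psd_on bball (\<lambda>x y. (1 - (\<Sum>t<1. \<Phi> t x * cnj (\<Phi> t y))) * schur_compl K b x y)" .
  from psd_on_null(2)[OF this xp(2,1)]
  show False
    using \<Phi>(2) ne b xp zero zero' by (simp add: W_def schur_compl_def)
qed

text \<open>To add p to P, factor B p on the enlarged set: (1 - B p) K is a rank one kernel, so the
  factors are admissible interpolation data and extend to a contractive row on the whole ball. It
  remains contractive on the functions vanishing at z, and there its form on the enlarged set is B z
  up to a congruence by \<open>K x p\<close> and a positive factor. Interpolating on the whole ball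
  is what lets the base point z be arbitrary.\<close>

theorem cnp_imp_complete_pick:
  assumes cnp: "cnp K" and nz: "\<And>x y. x \<in> bball \<Longrightarrow> y \<in> bball \<Longrightarrow> K x y \<noteq> 0"
  shows "complete_pick_kernel K"
proof -
  define B where "B z x y = 1 - K x z * K z y / (K x y * K z z)" for z x y
  have schur: "schur_compl K z x y = B z x y * K x y" if "x \<in> bball" "y \<in> bball" "z \<in> bball" for x y z
    using nz that by (simp add: B_def schur_compl_def field_simps)
  have "psd_on P (B z)" if "finite P" "P \<subseteq> bball" "z \<in> bball" for P z
    using that
  proof (induction P arbitrary: z rule: finite_induct)
    case empty
    then show ?case by (auto simp: psd_on_iff qform_def)
  next
    case (insert p P)
    have p: "p \<in> bball" and P: "insert p P \<subseteq> bball" "P \<subseteq> bball"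
      using insert.prems by auto
    have herm: "K p y = cnj (K y p)" if "y \<in> bball" for y
      using psd_on_hermitian[OF K_psd that p] .
    \<comment> \<open>The induction hypothesis with base point p covers only P; the row at p
      vanishes because \<open>B p x p\<close> is zero.\<close>
    have "psd_on (insert p P) (B p)"
      by (rule psd_on_insert_zero_row[OF insert.IH[OF P(2) p]]) (use nz P in \<open>auto simp: B_def\<close>)
    then obtain W where W: "\<forall>x\<in>insert p P. \<forall>y\<in>insert p P. B p x y = (\<Sum>t<card (insert p P). W x t * cnj (W y t))"
      using psd_on_Gram[of "insert p P" "B p"] insert.hyps(1) by blast
    let ?s = "card (insert p P)"
    have "psd_on (insert p P) (\<lambda>x y. (1 / K p p) * (K x p * cnj (K y p)))"
      using psd_on_diag[OF K_psd p] by (intro psd_on_scale psd_on_rank_one complex_inverse_nonneg)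
    then have WK: "psd_on (insert p P) (\<lambda>x y. (1 - (\<Sum>t<?s. W x t * cnj (W y t))) * K x y)"
    proof (rule psd_on_cong)
      fix x y assume xy: "x \<in> insert p P" "y \<in> insert p P"
      then have "x \<in> bball" "y \<in> bball" using P by auto
      moreover have "(\<Sum>t<?s. W x t * cnj (W y t)) = B p x y"
        using W[rule_format, OF xy] by simp
      ultimately show "(1 - (\<Sum>t<?s. W x t * cnj (W y t))) * K x y = (1 / K p p) * (K x p * cnj (K y p))"
        using nz herm by (simp add: B_def)
    qed
    have "0 < ?s" and "finite (insert p P)" using insert.hyps by (simp_all add: card_gt_0_iff)
    then obtain \<Phi> where \<Phi>: "psd_on bball (\<lambda>x y. (1 - (\<Sum>t<?s. \<Phi> t x * cnj (\<Phi> t y))) * K x y)"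
      "\<forall>x\<in>insert p P. \<forall>t<?s. \<Phi> t x = W x t"
      using cnp_row_interpolation[OF cnp _ P(1) _ WK] by auto
    have \<Phi>B: "1 - (\<Sum>t<?s. \<Phi> t x * cnj (\<Phi> t y)) = K x p * K p y / (K x y * K p p)" if "x \<in> insert p P" "y \<in> insert p P" for x y
    proof -
      have "(\<Sum>t<?s. \<Phi> t x * cnj (\<Phi> t y)) = (\<Sum>t<?s. W x t * cnj (W y t))"
        using \<Phi>(2) that by (intro sum.cong) auto
      also have "\<dots> = B p x y" using W[rule_format, OF that] by simp
      finally show ?thesis by (simp add: B_def)
    qed
    have "psd_on bball (\<lambda>x y. \<Sum>t<?s. \<Phi> t x * cnj (\<Phi> t y))"
      by (intro psd_on_sum psd_on_rank_one)
    from psd_on_schur_compl_mult[OF K_psd insert.prems(2) this \<Phi>(1)]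
    have "psd_on (insert p P) (\<lambda>x y. (1 - (\<Sum>t<?s. \<Phi> t x * cnj (\<Phi> t y))) * schur_compl K z x y)"
      by (rule psd_on_subset) (rule P)
    then have "psd_on (insert p P) (\<lambda>x y. K p p * (1 / K x p *
        ((1 - (\<Sum>t<?s. \<Phi> t x * cnj (\<Phi> t y))) * schur_compl K z x y) * cnj (1 / K y p)))"
      using psd_on_diag[OF K_psd p] by (intro psd_on_scale psd_on_congruence)
    then show ?case
    proof (rule psd_on_cong)
      fix x y assume xy: "x \<in> insert p P" "y \<in> insert p P"
      then have b: "x \<in> bball" "y \<in> bball" using P by auto
      show "B z x y = K p p * (1 / K x p *
        ((1 - (\<Sum>t<?s. \<Phi> t x * cnj (\<Phi> t y))) * schur_compl K z x y) * cnj (1 / K y p))"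
        unfolding \<Phi>B[OF xy] schur[OF b insert.prems(2)] using herm[OF b(2)] nz[OF b] nz[OF p p] nz[OF b(1) p] nz[OF b(2) p]
        by (simp add: field_simps)
    qed
  qed
  then have "psd_on bball (B z)" if "z \<in> bball" for z
    using that by (meson psd_onD psd_onI order_refl)
  then show ?thesis
    unfolding complete_pick_kernel_def using schur by blast
qed

end

section \<open>Regular unitarily invariant kernels\<close>

lemma cinner_diff_left: "cinner (x - y) w = cinner x w - cinner y w"
  by (simp add: cinner_def left_diff_distrib sum_subtractf)

lemma cinner_diff_right: "cinner x (y - w) = cinner x y - cinner x w"
  by (simp add: cinner_def right_diff_distrib sum_subtractf)

lemma cinner_scaleR_left: "cinner (r *\<^sub>R x) y = complex_of_real r * cinner x y"
  by (simp add: cinner_def sum_distrib_left scaleR_conv_of_real[where 'a = complex] mult.assoc)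

lemma cinner_scaleR_right: "cinner x (r *\<^sub>R y) = complex_of_real r * cinner x y"
  by (simp add: cinner_def sum_distrib_left scaleR_conv_of_real[where 'a = complex] mult_ac)

lemmas cinner_simps = cinner_diff_left cinner_diff_right cinner_scaleR_left cinner_scaleR_right

lemma cinner_self: "cinner z z = complex_of_real (\<Sum>j\<in>UNIV. (cmod (z$j))^2)"
  by (simp only: cinner_def of_real_sum complex_norm_square)

lemma cmod_cinner_less_1:
  assumes "z \<in> bball" "w \<in> bball"
  shows "cmod (cinner z w) < 1"
proof -
  have "(cmod (cinner z w))^2 \<le> Re (cinner z z) * Re (cinner w w)"
    using psd_on_Cauchy_Schwarz_entry[OF psd_on_cinner[of UNIV "\<lambda>x. x"]] by simp
  also have "\<dots> < 1 * 1"
    using assms by (intro mult_strict_mono') (auto simp: cinner_self bball_def sum_nonneg)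
  finally show ?thesis
    by (simp add: power_less_one_iff)
qed

lemma zero_in_bball: "0 \<in> bball"
  by (simp add: bball_def)

locale regular_kernel =
  fixes a :: "nat \<Rightarrow> real" and K :: "complex^'d \<Rightarrow> complex^'d \<Rightarrow> complex"
  assumes reg: "regular_coeffs a" and K_def: "K = ukernel a"
begin

lemma coeff_pos: "0 < a n"
  using reg by (cases "n = 0") (auto simp: regular_coeffs_def)

lemma coeff_0: "a 0 = 1"
  using reg by (simp add: regular_coeffs_def)

lemma eventually_ratio_gt: "b < 1 \<Longrightarrow> \<exists>N. \<forall>n\<ge>N. b * a (Suc n) \<le> a n"
proof -
  assume "b < 1"
  then have "\<forall>\<^sub>F n in sequentially. b < a n / a (Suc n)"
    using reg by (intro order_tendstoD) (auto simp: regular_coeffs_def)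
  then show ?thesis
    using coeff_pos by (auto simp: eventually_sequentially less_divide_eq intro: less_imp_le)
qed

lemma eventually_ratio_lt: "1 < b \<Longrightarrow> \<exists>N. \<forall>n\<ge>N. a n \<le> b * a (Suc n)"
proof -
  assume "1 < b"
  then have "\<forall>\<^sub>F n in sequentially. a n / a (Suc n) < b"
    using reg by (intro order_tendstoD) (auto simp: regular_coeffs_def)
  then show ?thesis
    using coeff_pos by (auto simp: eventually_sequentially divide_less_eq intro: less_imp_le)
qed

lemma K_sums:
  assumes "z \<in> bball" "w \<in> bball"
  shows "(\<lambda>n. complex_of_real (a n) * cinner z w ^ n) sums K z w"
proof -
  let ?r = "cmod (cinner z w)"
  \<comment> \<open>c will be the ratio in the ratio test: since ?r / c is below 1, eventually ?r
    \<open>a (Suc n)\<close> is at most c \<open>a n\<close>.\<close>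
  obtain c where c: "?r < c" "c < 1"
    using cmod_cinner_less_1[OF assms] dense by blast
  then have c0: "0 < c" by (meson le_less_trans norm_ge_zero)
  have "?r / c < 1" using c c0 by simp
  then obtain N where N: "\<And>n. n \<ge> N \<Longrightarrow> (?r / c) * a (Suc n) \<le> a n"
    using eventually_ratio_gt by blast
  have "summable (\<lambda>n. complex_of_real (a n) * cinner z w ^ n)"
  proof (rule summable_ratio_test[OF c(2), of N])
    fix n assume "N \<le> n"
    then have "?r * a (Suc n) \<le> c * a n"
      using N[of n] c0 by (simp add: field_simps)
    then have "(?r * a (Suc n)) * ?r ^ n \<le> (c * a n) * ?r ^ n"
      by (intro mult_right_mono) auto
    then show "cmod (complex_of_real (a (Suc n)) * cinner z w ^ Suc n) \<le> c * cmod (complex_of_real (a n) * cinner z w ^ n)"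
      using coeff_pos[of n] coeff_pos[of "Suc n"] by (simp add: norm_mult norm_power mult_ac)
  qed
  then show ?thesis
    unfolding K_def ukernel_def by (rule summable_sums)
qed

lemma series_psd:
  assumes "\<And>n. 0 \<le> c n"
    and "\<And>z w. z \<in> bball \<Longrightarrow> w \<in> bball \<Longrightarrow> (\<lambda>n. complex_of_real (c n) * cinner z w ^ n) sums L z w"
  shows "psd_on bball L"
proof (rule psd_on_limit)
  show "psd_on bball (\<lambda>z w. \<Sum>i<n. complex_of_real (c i) * cinner z w ^ i)" for n
    using assms(1) by (intro psd_on_sum psd_on_scale psd_on_power psd_on_cinner) (auto simp: less_eq_complex_def)
qed (use assms(2) in \<open>simp add: sums_def\<close>)

lemma K_psd: "psd_on bball K"
  by (rule series_psd[of a]) (use coeff_pos less_imp_le K_sums in auto)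

sublocale pos_kernel K
  by unfold_locales (rule K_psd)

lemma K_dominates_power: "psd_on bball (\<lambda>z w. K z w - complex_of_real (a n) * cinner z w ^ n)"
proof (rule series_psd[of "\<lambda>m. if m = n then 0 else a m"])
  fix z w :: "complex^'d" assume zw: "z \<in> bball" "w \<in> bball"
  have "(\<lambda>m. if m = n then complex_of_real (a m) * cinner z w ^ m else 0) sums (complex_of_real (a n) * cinner z w ^ n)"
    by (rule sums_single)
  from sums_diff[OF K_sums[OF zw] this]
  show "(\<lambda>m. complex_of_real (if m = n then 0 else a m) * cinner z w ^ m) sums
      (K z w - complex_of_real (a n) * cinner z w ^ n)"
    by (rule back_subst[where P = "\<lambda>f. f sums _"]) auto
qed (use coeff_pos less_imp_le in auto)

lemma K_minus_1_psd: "psd_on bball (\<lambda>z w. K z w - 1)"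
  using K_dominates_power[of 0] by (simp add: coeff_0)

lemma K_diag_nonzero: "z \<in> bball \<Longrightarrow> K z z \<noteq> 0"
  using psd_on_diag[OF K_minus_1_psd, of z] by (auto simp: less_eq_complex_def)

lemma K_zero: "K z 0 = 1" "K 0 z = 1"
proof -
  have "(\<Sum>n. complex_of_real (a n) * 0 ^ n) = 1"
    using powser_zero[of "\<lambda>n. complex_of_real (a n)"] by (simp add: coeff_0)
  then show "K z 0 = 1" "K 0 z = 1"
    by (simp_all add: K_def ukernel_def cinner_def)
qed

lemma shifted_K_sums:
  assumes "z \<in> bball" "w \<in> bball"
  shows "(\<lambda>k. complex_of_real (if k < n then 0 else a (k - n)) * cinner z w ^ k) sums (cinner z w ^ n * K z w)"
proof -
  have "(\<lambda>k. complex_of_real (if k + n < n then 0 else a (k + n - n)) * cinner z w ^ (k + n)) sums (cinner z w ^ n * K z w)"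
    using sums_mult[OF K_sums[OF assms], of "cinner z w ^ n"] by (simp add: power_add mult_ac)
  then show ?thesis
    by (subst (asm) sums_zero_iff_shift) auto
qed

lemma power_K_le:
  assumes "\<And>k. a k \<le> C * a (k + n)" "0 \<le> C"
  shows "psd_on bball (\<lambda>z w. complex_of_real C * K z w - cinner z w ^ n * K z w)"
proof (rule series_psd[of "\<lambda>k. C * a k - (if k < n then 0 else a (k - n))"])
  show "0 \<le> C * a k - (if k < n then 0 else a (k - n))" for k
    using assms(1)[of "k - n"] assms(2) coeff_pos[of k] by auto
  fix z w :: "complex^'d" assume zw: "z \<in> bball" "w \<in> bball"
  show "(\<lambda>k. complex_of_real (C * a k - (if k < n then 0 else a (k - n))) * cinner z w ^ k) sums
      (complex_of_real C * K z w - cinner z w ^ n * K z w)"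
    using sums_diff[OF sums_mult[OF K_sums[OF zw]] shifted_K_sums[OF zw, of n], of "complex_of_real C"]
    by (rule back_subst[where P = "\<lambda>f. f sums _"]) (auto simp: algebra_simps)
qed

text \<open>This expresses that the shift has spectral radius at most 1. From some N on each step
  costs at most a factor r; the finitely many earlier coefficients are compared through their
  maximum and minimum, and \<open>r ^ N\<close> pays for crossing N. Any r yields bounded
  coordinates; r close to 1 is what points just outside the closed ball require.\<close>

lemma coeff_growth:
  assumes "1 < r"
  shows "\<exists>C>0. \<forall>k n. a k \<le> C * r ^ n * a (k + n)"
proof -
  obtain N where N: "\<And>n. n \<ge> N \<Longrightarrow> a n \<le> r * a (Suc n)"
    using eventually_ratio_lt[OF assms] by blast
  have tail: "a k \<le> r ^ n * a (k + n)" if "N \<le> k" for k n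
  proof (induction n)
    case (Suc n)
    have "r ^ n * a (k + n) \<le> r ^ n * (r * a (Suc (k + n)))"
      using N[of "k + n"] that assms by (intro mult_left_mono) auto
    with Suc show ?case by (simp add: mult_ac)
  qed simp
  define A where "A = Max (a ` {..N})"
  define B where "B = Min (a ` {..N})"
  have A: "a k \<le> A" and B: "B \<le> a k" if "k \<le> N" for k
    using that by (auto simp: A_def B_def)
  have B0: "0 < B"
    unfolding B_def using coeff_pos by (subst Min_gr_iff) auto
  have AB: "B \<le> A" using A[of 0] B[of 0] by simp
  have "a k \<le> (A / B * r ^ N) * r ^ n * a (k + n)" for k n
  proof -
    have r: "1 \<le> r ^ m" for m using assms by simp
    have ABr: "1 \<le> A / B * r ^ N"
      using AB B0 mult_mono[of 1 "A / B" 1 "r ^ N"] r[of N] by simp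
    consider "N \<le> k" | "k < N" "k + n \<le> N" | "k < N" "N < k + n" by linarith
    then show ?thesis
    proof cases
      case 1
      have "a k \<le> 1 * (r ^ n * a (k + n))" using tail[OF 1] by simp
      also have "\<dots> \<le> (A / B * r ^ N) * (r ^ n * a (k + n))"
        using ABr r[of n] coeff_pos[of "k + n"] by (intro mult_right_mono) auto
      finally show ?thesis by (simp only: mult.assoc)
    next
      case 2
      have "a k \<le> A / B * B" using A[of k] 2 B0 by simp
      also have "\<dots> \<le> A / B * a (k + n)"
        using B[of "k + n"] 2 B0 AB by (intro mult_left_mono) auto
      also have "\<dots> \<le> (r ^ N * r ^ n) * (A / B * a (k + n))"
        using r[of "N + n"] coeff_pos[of "k + n"] B0 AB mult_right_mono[of 1 "r ^ N * r ^ n" "A / B * a (k + n)"]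
        by (simp add: power_add)
      finally show ?thesis by (simp add: mult_ac)
    next
      case 3
      have "a k \<le> A / B * B" using A[of k] 3 B0 by simp
      also have "\<dots> \<le> A / B * a N"
        using B[of N] B0 AB by (intro mult_left_mono) auto
      also have "\<dots> \<le> A / B * (r ^ (k + n - N) * a (k + n))"
        using tail[of N "k + n - N"] 3 B0 AB by (intro mult_left_mono) auto
      also have "\<dots> \<le> A / B * ((r ^ N * r ^ n) * a (k + n))"
      proof -
        have "r ^ (k + n - N) \<le> r ^ (N + n)" using assms 3 by (intro power_increasing) auto
        then show ?thesis
          using B0 AB coeff_pos[of "k + n"] by (intro mult_left_mono mult_right_mono) (auto simp: power_add)
      qed
      finally show ?thesis by (simp add: mult_ac)
    qed
  qed
  moreover have "0 < A / B * r ^ N" using AB B0 assms by simp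
  ultimately show ?thesis by blast
qed

lemma mult_alg_bcoord: "bcoord j \<in> mult_alg K"
proof -
  obtain C where C: "0 < C" "\<And>k n. a k \<le> C * 2 ^ n * a (k + n)"
    using coeff_growth[of 2] by auto
  have "psd_on bball (\<lambda>z w. complex_of_real (C * 2) * K z w - cinner z w ^ 1 * K z w)"
    by (rule power_K_le) (use C(2)[of _ 1] C(1) in auto)
  moreover have "psd_on bball (\<lambda>z w. (\<Sum>i\<in>UNIV - {j}. z$i * cnj (w$i)) * K z w)"
    by (intro psd_on_mult psd_on_sum psd_on_rank_one K_psd)
  ultimately have "psd_on bball (\<lambda>z w. (complex_of_real (C * 2) * K z w - cinner z w ^ 1 * K z w)
      + (\<Sum>i\<in>UNIV - {j}. z$i * cnj (w$i)) * K z w)"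
    by (rule psd_on_add)
  then have "psd_on bball (\<lambda>z w. (complex_of_real (C * 2) - bcoord j z * cnj (bcoord j w)) * K z w)"
  proof (rule psd_on_cong)
    fix z w :: "complex^'d" assume "z \<in> bball" "w \<in> bball"
    moreover have "cinner z w = z$j * cnj (w$j) + (\<Sum>i\<in>UNIV - {j}. z$i * cnj (w$i))"
      unfolding cinner_def by (subst sum.remove[of _ j]) auto
    ultimately show "(complex_of_real (C * 2) - bcoord j z * cnj (bcoord j w)) * K z w
      = (complex_of_real (C * 2) * K z w - cinner z w ^ 1 * K z w) + (\<Sum>i\<in>UNIV - {j}. z$i * cnj (w$i)) * K z w"
      by (simp add: bcoord_def algebra_simps)
  qed
  then show ?thesis
    using C(1) by (intro mult_algI[of _ "C * 2"]) (auto simp: bcoord_def)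
qed

end

section \<open>Division by the coordinate functions\<close>

context regular_kernel
begin

text \<open>The induction multiplies <z, w> \<le> 2 <z - p, w - p> + 2 |p|^2 by the n-th power of <z, w>, which is
  dominated by K.\<close>
lemma power_le_shifted:
  "\<exists>C\<ge>0. psd_on bball (\<lambda>z w. complex_of_real C * (cinner (z - p) (w - p) * K z w + 1) - cinner z w ^ n)"
proof (induction n)
  case 0
  have "psd_on bball (\<lambda>z w. cinner (z - p) (w - p) * K z w)"
    by (intro psd_on_mult psd_on_cinner K_psd)
  then show ?case
    by (intro exI[of _ 1]) simp
next
  case (Suc n)
  then obtain C where C: "0 \<le> C"
    "psd_on bball (\<lambda>z w. complex_of_real C * (cinner (z - p) (w - p) * K z w + 1) - cinner z w ^ n)"
    by blast
  define \<sigma> where "\<sigma> = (\<Sum>j\<in>UNIV. (cmod (p$j))^2)"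
  have \<sigma>: "0 \<le> \<sigma>" "cinner p p = complex_of_real \<sigma>"
    by (simp_all add: \<sigma>_def cinner_self sum_nonneg)
  have an: "0 < a n" by (rule coeff_pos)
  have 1: "psd_on bball (\<lambda>z w. cinner (z - p - p) (w - p - p) * cinner z w ^ n)"
    by (intro psd_on_mult psd_on_cinner psd_on_power)
  have 2: "psd_on bball (\<lambda>z w. complex_of_real (2 / a n) * (cinner (z - p) (w - p) * (K z w - complex_of_real (a n) * cinner z w ^ n)))"
    using an by (intro psd_on_scale psd_on_mult psd_on_cinner K_dominates_power) (simp add: less_eq_complex_def)
  have 3: "psd_on bball (\<lambda>z w. complex_of_real (2 * \<sigma>) * (complex_of_real C * (cinner (z - p) (w - p) * K z w + 1) - cinner z w ^ n))"
    using \<sigma> by (intro psd_on_scale C(2)) (simp add: less_eq_complex_def)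
  have 4: "psd_on bball (\<lambda>z w::complex^'d. complex_of_real (2 / a n))"
    using an by (intro psd_on_const) simp
  have "psd_on bball (\<lambda>z w. complex_of_real (2 / a n + 2 * \<sigma> * C) * (cinner (z - p) (w - p) * K z w + 1) - cinner z w ^ Suc n)"
  proof (rule psd_on_cong[OF psd_on_add[OF psd_on_add[OF psd_on_add[OF 1 2] 3] 4]])
    fix z w :: "complex^'d"
    \<comment> \<open>Parallelogram law for z - p and p: the defect in the estimate of \<langle>z,
      w\<rangle> is the positive kernel of z - 2p.\<close>
    have e: "cinner (z - p - p) (w - p - p) = 2 * cinner (z - p) (w - p) + 2 * complex_of_real \<sigma> - cinner z w"
      unfolding cinner_simps \<sigma>(2) by simp
    show "complex_of_real (2 / a n + 2 * \<sigma> * C) * (cinner (z - p) (w - p) * K z w + 1) - cinner z w ^ Suc n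
      = cinner (z - p - p) (w - p - p) * cinner z w ^ n
        + complex_of_real (2 / a n) * (cinner (z - p) (w - p) * (K z w - complex_of_real (a n) * cinner z w ^ n))
        + complex_of_real (2 * \<sigma>) * (complex_of_real C * (cinner (z - p) (w - p) * K z w + 1) - cinner z w ^ n)
        + complex_of_real (2 / a n)"
      unfolding e using an by (simp add: field_simps)
  qed
  then show ?case
    using an \<sigma> C(1) by (intro exI[of _ "2 / a n + 2 * \<sigma> * C"]) simp
qed

text \<open>Completing the square gives D \<ge> (1 - \<delta>)(\<langle>z, w\<rangle> - \<tau>) with
  \<tau> = |p|^2 / \<delta>, and the coefficient ratios give \<langle>z, w\<rangle> K \<ge> b (K -
  S), where S is a partial sum. Hence D K dominates (1 - \<delta>)(b - \<tau>) K up to a multiple of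
  S. Since |p| < 1, \<delta> can be taken strictly between |p|^2 and 1, and then b strictly between
  \<tau> and 1.\<close>

lemma K_le_shifted:
  assumes p: "p \<in> bball"
  shows "\<exists>C\<ge>0. psd_on bball (\<lambda>z w. complex_of_real C * (cinner (z - p) (w - p) * K z w + 1) - K z w)"
proof -
  define \<sigma> where "\<sigma> = (\<Sum>j\<in>UNIV. (cmod (p$j))^2)"
  have \<sigma>: "0 \<le> \<sigma>" "\<sigma> < 1" "cinner p p = complex_of_real \<sigma>"
    using p by (simp_all add: \<sigma>_def cinner_self sum_nonneg bball_def)
  define \<delta> where "\<delta> = (1 + \<sigma>) / 2"
  have \<delta>: "0 < \<delta>" "\<delta> < 1" "\<sigma> < \<delta>" using \<sigma> by (auto simp: \<delta>_def)
  define \<tau> where "\<tau> = \<sigma> / \<delta>"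
  have \<tau>: "0 \<le> \<tau>" "\<tau> < 1" using \<delta> \<sigma> by (auto simp: \<tau>_def)
  define b where "b = (\<tau> + 1) / 2"
  have b: "\<tau> < b" "b < 1" "0 \<le> b" using \<tau> by (auto simp: b_def)
  obtain N where N: "\<And>n. n \<ge> N \<Longrightarrow> b * a (Suc n) \<le> a n"
    using eventually_ratio_gt[OF b(2)] by blast
  define S where "S z w = (\<Sum>n\<le>N. complex_of_real (a n) * cinner z w ^ n)" for z w :: "complex^'d"
  have 1: "psd_on bball (\<lambda>z w. complex_of_real (1 / (1 - \<delta>)) *
      (complex_of_real \<delta> * (cinner (z - (1/\<delta>) *\<^sub>R p) (w - (1/\<delta>) *\<^sub>R p) * K z w)))"
    using \<delta> by (intro psd_on_scale psd_on_mult psd_on_cinner K_psd) (auto simp: less_eq_complex_def)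
  have 2: "psd_on bball (\<lambda>z w. cinner z w * K z w - complex_of_real b * K z w + complex_of_real b * S z w)"
  proof (rule series_psd[of "\<lambda>k. (if k < 1 then 0 else a (k - 1)) - b * a k + (if k \<in> {..N} then b * a k else 0)"])
    fix k show "0 \<le> (if k < 1 then 0 else a (k - 1)) - b * a k + (if k \<in> {..N} then b * a k else 0)"
      using N[of "k - 1"] coeff_pos[of "k - 1"] by (cases "k = 0") auto
  next
    fix z w :: "complex^'d" assume zw: "z \<in> bball" "w \<in> bball"
    have "(\<lambda>k. if k \<in> {..N} then complex_of_real b * (complex_of_real (a k) * cinner z w ^ k) else 0) sums (complex_of_real b * S z w)"
      unfolding S_def sum_distrib_left by (intro sums_If_finite_set) simp
    from sums_add[OF sums_diff[OF shifted_K_sums[OF zw, of 1] sums_mult[OF K_sums[OF zw], of "complex_of_real b"]] this]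
    show "(\<lambda>k. complex_of_real ((if k < 1 then 0 else a (k - 1)) - b * a k + (if k \<in> {..N} then b * a k else 0)) * cinner z w ^ k)
       sums (cinner z w * K z w - complex_of_real b * K z w + complex_of_real b * S z w)"
      unfolding power_one_right by (rule back_subst[where P = "\<lambda>f. f sums _"]) (auto simp: algebra_simps)
  qed
  define c where "c n = (SOME C. 0 \<le> C \<and>
    psd_on bball (\<lambda>z w. complex_of_real C * (cinner (z - p) (w - p) * K z w + 1) - cinner z w ^ n))" for n
  have "0 \<le> c n \<and> psd_on bball (\<lambda>z w. complex_of_real (c n) * (cinner (z - p) (w - p) * K z w + 1) - cinner z w ^ n)" for n
    unfolding c_def by (rule someI_ex[OF power_le_shifted])
  then have c: "0 \<le> c n"
    "psd_on bball (\<lambda>z w. complex_of_real (c n) * (cinner (z - p) (w - p) * K z w + 1) - cinner z w ^ n)" for n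
    by simp_all
  define C1 where "C1 = (\<Sum>n\<le>N. a n * c n)"
  have C1: "0 \<le> C1"
    unfolding C1_def using c(1) coeff_pos by (intro sum_nonneg mult_nonneg_nonneg) (auto intro: less_imp_le)
  have "psd_on bball (\<lambda>z w. \<Sum>n\<le>N. complex_of_real (a n) *
      (complex_of_real (c n) * (cinner (z - p) (w - p) * K z w + 1) - cinner z w ^ n))"
    using coeff_pos by (intro psd_on_sum psd_on_scale c(2)) (auto simp: less_eq_complex_def less_imp_le)
  then have 3: "psd_on bball (\<lambda>z w. complex_of_real C1 * (cinner (z - p) (w - p) * K z w + 1) - S z w)"
    by (rule psd_on_cong) (simp add: C1_def S_def right_diff_distrib sum_subtractf sum_distrib_right mult.assoc)
  then have 3: "psd_on bball (\<lambda>z w. complex_of_real b * (complex_of_real C1 * (cinner (z - p) (w - p) * K z w + 1) - S z w))"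
    using b by (intro psd_on_scale) (auto simp: less_eq_complex_def)
  \<comment> \<open>Added so that one common factor C multiplies both D K and the constant
    1.\<close>
  have 4: "psd_on bball (\<lambda>z w::complex^'d. complex_of_real (1 / (1 - \<delta>)))"
    using \<delta> by (intro psd_on_const) simp
  define C where "C = (1 / (1 - \<delta>) + b * C1) / (b - \<tau>)"
  have "psd_on bball (\<lambda>z w. complex_of_real C * (cinner (z - p) (w - p) * K z w + 1) - K z w)"
  proof (rule psd_on_cong[OF psd_on_scale[OF psd_on_add[OF psd_on_add[OF psd_on_add[OF 1 2] 3] 4]]])
    show "0 \<le> complex_of_real (1 / (b - \<tau>))"
      using b by (simp add: less_eq_complex_def)
    fix z w :: "complex^'d"
    define D where "D = cinner (z - p) (w - p)"
    have e: "complex_of_real \<delta> * cinner (z - (1/\<delta>) *\<^sub>R p) (w - (1/\<delta>) *\<^sub>R p)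
      = D - complex_of_real (1 - \<delta>) * (cinner z w - complex_of_real \<tau>)"
      using \<delta> by (simp add: D_def cinner_simps \<sigma>(3) \<tau>_def field_simps)
    have "complex_of_real (1 / (1 - \<delta>)) * (complex_of_real \<delta> * (cinner (z - (1/\<delta>) *\<^sub>R p) (w - (1/\<delta>) *\<^sub>R p) * K z w))
       = complex_of_real (1 / (1 - \<delta>)) * (D * K z w) - (cinner z w - complex_of_real \<tau>) * K z w"
      unfolding mult.assoc[symmetric, of "complex_of_real \<delta>"] e using \<delta> by (simp add: field_simps)
    moreover have "complex_of_real C = complex_of_real (1 / (b - \<tau>)) * (complex_of_real (1 / (1 - \<delta>)) + complex_of_real b * complex_of_real C1)"
      by (simp add: C_def)
    moreover have "complex_of_real (1 / (b - \<tau>)) * (complex_of_real b - complex_of_real \<tau>) = 1"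
      using b by (simp flip: of_real_diff)
    ultimately show "complex_of_real C * (cinner (z - p) (w - p) * K z w + 1) - K z w
      = complex_of_real (1 / (b - \<tau>)) * (complex_of_real (1 / (1 - \<delta>)) *
         (complex_of_real \<delta> * (cinner (z - (1/\<delta>) *\<^sub>R p) (w - (1/\<delta>) *\<^sub>R p) * K z w))
        + (cinner z w * K z w - complex_of_real b * K z w + complex_of_real b * S z w)
        + complex_of_real b * (complex_of_real C1 * (cinner (z - p) (w - p) * K z w + 1) - S z w)
        + complex_of_real (1 / (1 - \<delta>)))"
      unfolding D_def by algebra
  qed
  moreover have "0 \<le> C"
    using b \<delta> C1 by (auto simp: C_def)
  ultimately show ?thesis by blast
qed

text \<open>Both kernels have zero row and column at p, so the coefficient there can be chosen to
  make all coefficients sum to zero. Such a vector annihilates the constant in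
  \<open>K_le_shifted\<close>, and the rank one part of K only helps.\<close>

lemma schur_compl_le_shifted:
  assumes p: "p \<in> bball"
  shows "\<exists>C>0. psd_on bball (\<lambda>z w. complex_of_real C * (cinner (z - p) (w - p) * K z w) - schur_compl K p z w)"
proof -
  obtain C where C: "0 \<le> C" "psd_on bball (\<lambda>z w. complex_of_real C * (cinner (z - p) (w - p) * K z w + 1) - K z w)"
    using K_le_shifted[OF p] by blast
  have rank: "psd_on bball (\<lambda>z w. K z p * K p w / K p p)"
  proof -
    have "psd_on bball (\<lambda>x y. (1 / K p p) * (K x p * cnj (K y p)))"
      using psd_on_diag[OF K_psd p] by (intro psd_on_scale psd_on_rank_one complex_inverse_nonneg)
    then show ?thesis
      by (rule psd_on_cong) (use psd_on_hermitian[OF K_psd _ p] in auto)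
  qed
  define M where "M z w = complex_of_real C * (cinner (z - p) (w - p) * K z w) - schur_compl K p z w" for z w
  have "psd_on bball M"
  proof (rule psd_on_zero_rowI[OF p])
    show "M x p = 0" "M p x = 0" if "x \<in> bball" for x
      using schur_compl_zero[OF K_psd that p] by (simp_all add: M_def cinner_def)
  next
    fix F and c :: "complex^'d \<Rightarrow> complex" assume F: "finite F" "F \<subseteq> bball" "p \<notin> F"
    let ?c = "c(p := - (\<Sum>x\<in>F. c x))"
    have fin: "finite (insert p F)" "insert p F \<subseteq> bball" using F p by auto
    have "(\<Sum>x\<in>F. ?c x) = (\<Sum>x\<in>F. c x)"
      using F by (intro sum.cong) auto
    then have "(\<Sum>x\<in>insert p F. ?c x * 1) = 0"
      using F by simp
    then have one: "qform (insert p F) ?c (\<lambda>z w. complex_of_real C * (1 * cnj 1)) = 0"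
      using qform_rank_one[of "insert p F" ?c "\<lambda>_. 1"] by (simp only: qform_scale) simp
    have "qform (insert p F) ?c M = qform (insert p F) ?c (\<lambda>z w.
       ((complex_of_real C * (cinner (z - p) (w - p) * K z w + 1) - K z w) + K z p * K p w / K p p) - complex_of_real C * (1 * cnj 1))"
      by (intro qform_cong) (simp_all add: M_def schur_compl_def algebra_simps)
    also have "\<dots> = qform (insert p F) ?c (\<lambda>z w. complex_of_real C * (cinner (z - p) (w - p) * K z w + 1) - K z w)
       + qform (insert p F) ?c (\<lambda>z w. K z p * K p w / K p p)"
      unfolding qform_diff[of _ _ _ "\<lambda>z w. complex_of_real C * (1 * cnj 1)"] one
      by (simp only: qform_add diff_0_right)
    also have "0 \<le> \<dots>"
      by (intro add_nonneg_nonneg psd_onD[OF C(2) fin] psd_onD[OF rank fin])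
    finally show "\<exists>s. 0 \<le> qform (insert p F) (c(p := s)) M" ..
  qed
  \<comment> \<open>One further copy of D K makes the constant strictly positive.\<close>
  moreover have "psd_on bball (\<lambda>z w. cinner (z - p) (w - p) * K z w)"
    by (intro psd_on_mult psd_on_cinner K_psd)
  ultimately have "psd_on bball (\<lambda>z w. M z w + cinner (z - p) (w - p) * K z w)"
    by (rule psd_on_add)
  then have "psd_on bball (\<lambda>z w. complex_of_real (C + 1) * (cinner (z - p) (w - p) * K z w) - schur_compl K p z w)"
    by (rule psd_on_cong) (simp add: M_def algebra_simps)
  then show ?thesis
    using C(1) by (intro exI[of _ "C + 1"]) auto
qed

theorem gleason_division:
  assumes cnp: "cnp K" and p: "p \<in> bball" and h: "h \<in> mult_alg K" "h p = 0"
  shows "\<exists>g. (\<forall>j. g j \<in> mult_alg K) \<and> (\<forall>z\<in>bball. h z = (\<Sum>j\<in>UNIV. (z$j - p$j) * g j z))"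
proof -
  have "K x y \<noteq> 0" if "x \<in> bball" "y \<in> bball" for x y
    using cnp_kernel_nonzero[OF cnp K_diag_nonzero zero_in_bball _ _ that] K_zero by blast
  then have cp: "complete_pick_kernel K"
    by (intro cnp_imp_complete_pick[OF cnp])
  obtain M where M: "0 \<le> M" "psd_on bball (\<lambda>z w. (complex_of_real M - h z * cnj (h w)) * K z w)"
    using mult_alg_bounded[OF h(1)] by blast
  \<comment> \<open>M may be 0; a positive constant avoids a vanishing denominator in the Schur
    complement below. As h vanishes at p, that complement subtracts only M1 times the rank one part
    of K.\<close>
  define M1 where "M1 = M + 1"
  have M1: "0 < M1" using M by (simp add: M1_def)
  have "psd_on bball (\<lambda>z w. (complex_of_real M - h z * cnj (h w)) * K z w + K z w)"
    by (intro psd_on_add M(2) K_psd)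
  then have "psd_on bball (\<lambda>z w. (complex_of_real M1 - h z * cnj (h w)) * K z w)"
    by (rule psd_on_cong) (simp add: M1_def algebra_simps)
  from psd_on_schur_compl[OF this p]
  have 1: "psd_on bball (\<lambda>z w. complex_of_real M1 * schur_compl K p z w - h z * cnj (h w) * K z w)"
    by (rule psd_on_cong) (use M1 h(2) in \<open>simp add: schur_compl_def algebra_simps\<close>)
  obtain C where C: "0 < C" "psd_on bball (\<lambda>z w. complex_of_real C * (cinner (z - p) (w - p) * K z w) - schur_compl K p z w)"
    using schur_compl_le_shifted[OF p] by blast
  have 2: "psd_on bball (\<lambda>z w. complex_of_real M1 * (complex_of_real C * (cinner (z - p) (w - p) * K z w) - schur_compl K p z w))"
    using M1 by (intro psd_on_scale C(2)) (simp add: less_eq_complex_def)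
  \<comment> \<open>The factorisation is stated for contractions, so the constants are absorbed into
    the row U(z) = r (z - p) and r is returned to the factors at the end.\<close>
  define r where "r = sqrt (M1 * C)"
  have r: "0 < r" "complex_of_real r * complex_of_real r = complex_of_real M1 * complex_of_real C"
    using M1 C(1) by (simp_all add: r_def flip: of_real_mult)
  have "psd_on bball (\<lambda>z w. (cinner (r *\<^sub>R (z - p)) (r *\<^sub>R (w - p)) - h z * cnj (h w)) * K z w)"
  proof (rule psd_on_cong[OF psd_on_add[OF 1 2]])
    fix z w :: "complex^'d"
    have "cinner (r *\<^sub>R (z - p)) (r *\<^sub>R (w - p)) = complex_of_real M1 * complex_of_real C * cinner (z - p) (w - p)"
      unfolding cinner_scaleR_left cinner_scaleR_right using r(2) by (simp add: mult.assoc[symmetric])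
    then show "(cinner (r *\<^sub>R (z - p)) (r *\<^sub>R (w - p)) - h z * cnj (h w)) * K z w
      = complex_of_real M1 * schur_compl K p z w - h z * cnj (h w) * K z w
       + complex_of_real M1 * (complex_of_real C * (cinner (z - p) (w - p) * K z w) - schur_compl K p z w)"
      by (simp add: algebra_simps)
  qed
  from leech_factorisation[OF cp K_diag_nonzero this]
  obtain g where g: "\<And>j. g j \<in> mult_alg K" "\<And>z. z \<in> bball \<Longrightarrow> h z = (\<Sum>j\<in>UNIV. (r *\<^sub>R (z - p)) $ j * g j z)"
    by blast
  show ?thesis
  proof (intro exI[of _ "\<lambda>j z. complex_of_real r * g j z"] conjI allI ballI)
    show "(\<lambda>z. complex_of_real r * g j z) \<in> mult_alg K" for j
      by (intro mult_alg_scale g)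
    show "h z = (\<Sum>j\<in>UNIV. (z$j - p$j) * (complex_of_real r * g j z))" if "z \<in> bball" for z
      unfolding g(2)[OF that] by (simp add: scaleR_conv_of_real[where 'a = complex] mult_ac)
  qed
qed

section \<open>Inverses and points outside the closed ball\<close>

text \<open>Congruence by 1 / u turns the lower bound for u into an upper bound for 1 / u. Off the
  ball 1 / 0 = 0 agrees with the normalisation.\<close>

lemma mult_alg_inverse:
  assumes u: "\<And>z. z \<notin> bball \<Longrightarrow> u z = 0" and e: "0 < e"
    and psd: "psd_on bball (\<lambda>z w. u z * cnj (u w) * K z w - complex_of_real e * K z w)"
  shows "(\<lambda>z. 1 / u z) \<in> mult_alg K" "\<And>z. z \<in> bball \<Longrightarrow> u z \<noteq> 0"
proof -
  show nz: "u z \<noteq> 0" if z: "z \<in> bball" for z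
  proof
    assume "u z = 0"
    then have "0 \<le> - (complex_of_real e * K z z)"
      using psd_on_diag[OF psd z] by simp
    moreover have "1 \<le> Re (K z z)"
      using psd_on_diag[OF K_minus_1_psd z] by (simp add: less_eq_complex_def)
    ultimately show False
      using e by (simp add: less_eq_complex_def mult_le_0_iff)
  qed
  have "psd_on bball (\<lambda>z w. complex_of_real (1 / e) * (1 / u z * (u z * cnj (u w) * K z w - complex_of_real e * K z w) * cnj (1 / u w)))"
    using e by (intro psd_on_scale psd_on_congruence psd) (simp add: less_eq_complex_def)
  then have "psd_on bball (\<lambda>z w. (complex_of_real (1 / e) - 1 / u z * cnj (1 / u w)) * K z w)"
    by (rule psd_on_cong) (use nz e in \<open>simp add: field_simps\<close>)
  then show "(\<lambda>z. 1 / u z) \<in> mult_alg K"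
    using e u by (intro mult_algI[of _ "1 / e"]) auto
qed

lemma division_outside:
  assumes p: "p \<notin> cbball"
  shows "\<exists>g. (\<forall>j. g j \<in> mult_alg K) \<and> (\<forall>z\<in>bball. 1 = (\<Sum>j\<in>UNIV. (z$j - p$j) * g j z))"
proof -
  define \<sigma> where "\<sigma> = (\<Sum>j\<in>UNIV. (cmod (p$j))^2)"
  have \<sigma>: "1 < \<sigma>" "cinner p p = complex_of_real \<sigma>"
    using p by (simp_all add: \<sigma>_def cinner_self cbball_def)
  define r where "r = (1 + \<sigma>) / 2"
  have r: "1 < r" "r < \<sigma>" using \<sigma> by (auto simp: r_def)
  obtain C where C: "0 < C" "\<And>k n. a k \<le> C * r ^ n * a (k + n)"
    using coeff_growth[OF r(1)] by blast
  have "(\<lambda>n. C * (r / \<sigma>) ^ n) \<longlonglongrightarrow> C * 0"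
    using r by (intro tendsto_mult tendsto_const LIMSEQ_power_zero) auto
  then have "\<forall>\<^sub>F n in sequentially. C * (r / \<sigma>) ^ n < 1/4"
    by (rule order_tendstoD) simp
  then obtain n where n: "C * (r / \<sigma>) ^ n < 1/4"
    by (auto simp: eventually_sequentially)
  define \<phi> where "\<phi> z = (if z \<in> bball then cinner z p / complex_of_real \<sigma> else 0)" for z
  have \<phi>: "\<phi> \<in> mult_alg K"
  proof -
    have "(\<lambda>z. \<Sum>j\<in>UNIV. (cnj (p$j) / complex_of_real \<sigma>) * bcoord j z) \<in> mult_alg K"
      by (intro mult_alg_sum mult_alg_scale mult_alg_bcoord)
    also have "(\<lambda>z. \<Sum>j\<in>UNIV. (cnj (p$j) / complex_of_real \<sigma>) * bcoord j z) = \<phi>"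
      by (auto simp: \<phi>_def bcoord_def cinner_def sum_divide_distrib mult_ac)
    finally show ?thesis .
  qed
  \<comment> \<open>For m = 1 this is positivity of the Schur complement at p of the inner product;
    powers follow from x^(m+1) - y^(m+1) = x (x^m - y^m) + (x - y) y^m.\<close>
  have \<phi>_le: "psd_on bball (\<lambda>z w. (cinner z w / complex_of_real \<sigma>) ^ m - (\<phi> z * cnj (\<phi> w)) ^ m)" for m
  proof (induction m)
    case 0
    then show ?case using psd_on_zero by simp
  next
    case (Suc m)
    have base: "psd_on bball (\<lambda>z w :: complex^'d. cinner z w / complex_of_real \<sigma>)"
      using psd_on_scale[OF psd_on_cinner[of bball "\<lambda>x::complex^'d. x"], of "complex_of_real (1 / \<sigma>)"] \<sigma>
      by (simp add: less_eq_complex_def)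
    have "psd_on UNIV (schur_compl cinner p)"
      using psd_on_schur_compl[OF psd_on_cinner[of UNIV "\<lambda>x::complex^'d. x"]] by simp
    from psd_on_subset[OF this subset_UNIV]
    have "psd_on bball (\<lambda>z w. complex_of_real (1 / \<sigma>) * schur_compl cinner p z w)"
      by (rule psd_on_scale) (use \<sigma> in \<open>simp add: less_eq_complex_def\<close>)
    then have one: "psd_on bball (\<lambda>z w. cinner z w / complex_of_real \<sigma> - \<phi> z * cnj (\<phi> w))"
    proof (rule psd_on_cong)
      fix z w :: "complex^'d" assume "z \<in> bball" "w \<in> bball"
      moreover have "cnj (cinner w p) = cinner p w"
        by (simp add: cinner_def mult.commute)
      ultimately show "cinner z w / complex_of_real \<sigma> - \<phi> z * cnj (\<phi> w) = complex_of_real (1 / \<sigma>) * schur_compl cinner p z w"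
        by (simp add: \<phi>_def schur_compl_def \<sigma>(2) diff_divide_distrib)
    qed
    have "psd_on bball (\<lambda>z w. (cinner z w / complex_of_real \<sigma>) * ((cinner z w / complex_of_real \<sigma>) ^ m - (\<phi> z * cnj (\<phi> w)) ^ m)
       + (cinner z w / complex_of_real \<sigma> - \<phi> z * cnj (\<phi> w)) * (\<phi> z * cnj (\<phi> w)) ^ m)"
      by (intro psd_on_add psd_on_mult base Suc one psd_on_power psd_on_rank_one)
    then show ?case
      by (rule psd_on_cong) (simp add: algebra_simps)
  qed
  define u where "u z = bconst 1 z * (1 - \<phi> z ^ n)" for z
  have 1: "psd_on bball (\<lambda>z w. ((cinner z w / complex_of_real \<sigma>) ^ n - (\<phi> z * cnj (\<phi> w)) ^ n) * K z w)"
    by (intro psd_on_mult \<phi>_le K_psd)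
  have "psd_on bball (\<lambda>z w. complex_of_real (C * r ^ n) * K z w - cinner z w ^ n * K z w)"
    by (rule power_K_le) (use C r in auto)
  then have 2: "psd_on bball (\<lambda>z w. complex_of_real (1 / \<sigma> ^ n) * (complex_of_real (C * r ^ n) * K z w - cinner z w ^ n * K z w))"
    using \<sigma> by (intro psd_on_scale) (auto simp: less_eq_complex_def)
  have 3: "psd_on bball (\<lambda>z w. complex_of_real (1/4 - C * (r / \<sigma>) ^ n) * K z w)"
    using n by (intro psd_on_scale K_psd) (simp add: less_eq_complex_def)
  \<comment> \<open>With t = \<phi>^n the lower bound rests on |1 - t|^2 - 1/4 = (1/4 - |t|^2) + |1
    - 2t|^2 / 2; the first three kernels together express 1/4 - |t|^2.\<close>
  have 4: "psd_on bball (\<lambda>z w. complex_of_real (1/2) * (((1 - 2 * \<phi> z ^ n) * cnj (1 - 2 * \<phi> w ^ n)) * K z w))"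
    by (intro psd_on_scale psd_on_mult psd_on_rank_one K_psd) (simp add: less_eq_complex_def)
  have "psd_on bball (\<lambda>z w. u z * cnj (u w) * K z w - complex_of_real (1/4) * K z w)"
  proof (rule psd_on_cong[OF psd_on_add[OF psd_on_add[OF psd_on_add[OF 1 2] 3] 4]])
    fix z w :: "complex^'d" assume zw: "z \<in> bball" "w \<in> bball"
    have s: "complex_of_real (1 / \<sigma> ^ n) * complex_of_real (C * r ^ n) = complex_of_real (C * (r / \<sigma>) ^ n)"
      "(cinner z w / complex_of_real \<sigma>) ^ n = complex_of_real (1 / \<sigma> ^ n) * cinner z w ^ n"
      by (simp_all add: power_divide)
    show "u z * cnj (u w) * K z w - complex_of_real (1/4) * K z w
      = ((cinner z w / complex_of_real \<sigma>) ^ n - (\<phi> z * cnj (\<phi> w)) ^ n) * K z w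
       + complex_of_real (1 / \<sigma> ^ n) * (complex_of_real (C * r ^ n) * K z w - cinner z w ^ n * K z w)
       + complex_of_real (1/4 - C * (r / \<sigma>) ^ n) * K z w
       + complex_of_real (1/2) * (((1 - 2 * \<phi> z ^ n) * cnj (1 - 2 * \<phi> w ^ n)) * K z w)"
      unfolding s(2) right_diff_distrib mult.assoc[symmetric, of "complex_of_real (1 / \<sigma> ^ n)"] s(1)
      using zw by (simp add: u_def bconst_def algebra_simps)
  qed
  note inv = mult_alg_inverse[OF _ _ this]
  have inv_u: "(\<lambda>z. 1 / u z) \<in> mult_alg K" and u0: "\<And>z. z \<in> bball \<Longrightarrow> u z \<noteq> 0"
    by (rule inv; simp add: u_def bconst_def)+
  \<comment> \<open>From 1 - \<phi> = - \<langle>z - p, p\<rangle> / \<sigma> and the geometric sum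
    for 1 - \<phi>^n, divided by u.\<close>
  define g where "g j z = (- cnj (p$j) / complex_of_real \<sigma>) * ((\<Sum>k<n. bconst 1 z * \<phi> z ^ k) * (1 / u z))" for j z
  have "g j \<in> mult_alg K" for j
    unfolding g_def by (intro mult_alg_scale mult_alg_mult mult_alg_sum mult_alg_power \<phi> inv_u)
  moreover have "1 = (\<Sum>j\<in>UNIV. (z$j - p$j) * g j z)" if z: "z \<in> bball" for z
  proof -
    define q where "q = (\<Sum>k<n. \<phi> z ^ k) * (1 / u z)"
    have g: "g j z = (- cnj (p$j) / complex_of_real \<sigma>) * q" for j
      using z by (simp add: g_def q_def bconst_def)
    have "(\<Sum>j\<in>UNIV. (z$j - p$j) * g j z) = (\<Sum>j\<in>UNIV. (z - p)$j * cnj (p$j)) * (- q / complex_of_real \<sigma>)"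
      unfolding g sum_distrib_right by (intro sum.cong) auto
    also have "(\<Sum>j\<in>UNIV. (z - p)$j * cnj (p$j)) = cinner z p - complex_of_real \<sigma>"
      by (simp only: cinner_def[symmetric] cinner_diff_left \<sigma>(2))
    also have "(cinner z p - complex_of_real \<sigma>) * (- q / complex_of_real \<sigma>) = (1 - \<phi> z) * q"
      using z \<sigma>(1) by (simp add: \<phi>_def field_simps)
    also have "\<dots> = (1 - \<phi> z ^ n) / u z"
      unfolding q_def one_diff_power_eq by simp
    also have "\<dots> = 1"
      using z u0[OF z] by (simp add: u_def bconst_def)
    finally show ?thesis by simp
  qed
  ultimately show ?thesis by blast
qed

end

section \<open>Supports of ideals\<close>

lemma supp_antimono: "A \<subseteq> B \<Longrightarrow> supp K B \<subseteq> supp K A"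
  unfolding supp_def by blast

lemma wstar_closure_mono: "S \<subseteq> T \<Longrightarrow> wstar_closure K S \<subseteq> wstar_closure K T"
  unfolding wstar_closure_def by blast

lemma subset_wstar_closure: "S \<subseteq> mult_alg K \<Longrightarrow> S \<subseteq> wstar_closure K S"
  unfolding wstar_closure_def by (intro subsetI CollectI conjI allI impI) (auto intro!: bexI)

lemma mult_ideal_sum:
  "mult_ideal K A \<Longrightarrow> (\<And>i. i \<in> I \<Longrightarrow> f i \<in> A) \<Longrightarrow> (\<lambda>z. \<Sum>i\<in>I. f i z) \<in> A"
  by (induction I rule: infinite_finite_induct) (simp_all add: mult_ideal_def)

lemma ideal_prod_subset:
  assumes "mult_ideal K A" "mult_ideal K B"
  shows "ideal_prod A B \<subseteq> A \<inter> B"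
proof
  fix x assume "x \<in> ideal_prod A B"
  then obtain n :: nat and f g where x: "x = (\<lambda>z. \<Sum>i<n. f i z * g i z)" and fg: "\<forall>i<n. f i \<in> A \<and> g i \<in> B"
    by (auto simp: ideal_prod_def)
  have "(\<lambda>z. g i z * f i z) \<in> A" "(\<lambda>z. f i z * g i z) \<in> B" if "i < n" for i
    using that fg assms by (auto simp: mult_ideal_def)
  then have "(\<lambda>z. \<Sum>i<n. g i z * f i z) \<in> A" "(\<lambda>z. \<Sum>i<n. f i z * g i z) \<in> B"
    using assms by (auto intro!: mult_ideal_sum)
  then show "x \<in> A \<inter> B"
    by (simp add: x mult.commute)
qed

context pos_kernel
begin

lemma notin_supp_iff:
  assumes "A \<subseteq> mult_alg K"
  shows "z \<notin> supp K A \<longleftrightarrow>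
    (\<exists>f\<in>A. \<exists>g. (\<forall>j. g j \<in> mult_alg K) \<and> (\<forall>w\<in>bball. 1 = f w + (\<Sum>j\<in>UNIV. (w$j - z$j) * g j w)))"
proof -
  have "bconst 1 = (\<lambda>w. f w + (\<Sum>j\<in>UNIV. (bcoord j w - bconst (z$j) w) * g j w))
      \<longleftrightarrow> (\<forall>w\<in>bball. 1 = f w + (\<Sum>j\<in>UNIV. (w$j - z$j) * g j w))" if "f \<in> A" for f g
    using mult_alg_zero_off[of f] that assms by (auto simp: fun_eq_iff bconst_def bcoord_def)
  then show ?thesis
    unfolding supp_def by blast
qed

text \<open>Multiply two representations of 1: inserting 1 = f' + s' into 1 = f + s as a factor of f
  gives 1 = f f' + (f s' + s), where s and s' are combinations of the shifted coordinates.\<close>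

lemma supp_ideal_prod_subset:
  assumes A: "mult_ideal K A" and B: "mult_ideal K B"
  shows "supp K (ideal_prod A B) \<subseteq> supp K A \<union> supp K B"
proof (rule subsetI, rule ccontr)
  fix z assume z: "z \<in> supp K (ideal_prod A B)" and "z \<notin> supp K A \<union> supp K B"
  then have zA: "z \<notin> supp K A" and zB: "z \<notin> supp K B" by auto
  have sub: "A \<subseteq> mult_alg K" "B \<subseteq> mult_alg K" "ideal_prod A B \<subseteq> mult_alg K"
    using A B ideal_prod_subset[OF A B] by (auto simp: mult_ideal_def)
  obtain f g where f: "f \<in> A" "\<forall>j. g j \<in> mult_alg K"
    "\<forall>w\<in>bball. 1 = f w + (\<Sum>j\<in>UNIV. (w$j - z$j) * g j w)"
    using zA unfolding notin_supp_iff[OF sub(1)] by blast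
  obtain f' g' where f': "f' \<in> B" "\<forall>j. g' j \<in> mult_alg K"
    "\<forall>w\<in>bball. 1 = f' w + (\<Sum>j\<in>UNIV. (w$j - z$j) * g' j w)"
    using zB unfolding notin_supp_iff[OF sub(2)] by blast
  define G where "G j w = f w * g' j w + g j w" for j w
  have "(\<lambda>w. f w * f' w) \<in> ideal_prod A B"
    unfolding ideal_prod_def using f(1) f'(1)
    by (intro CollectI exI[of _ 1] exI[of _ "\<lambda>_. f"] exI[of _ "\<lambda>_. f'"]) auto
  moreover have "G j \<in> mult_alg K" for j
    unfolding G_def using f f' sub by (intro mult_alg_add mult_alg_mult) auto
  moreover have "1 = f w * f' w + (\<Sum>j\<in>UNIV. (w$j - z$j) * G j w)" if "w \<in> bball" for w
  proof -
    have "(\<Sum>j\<in>UNIV. (w$j - z$j) * G j w) = f w * (\<Sum>j\<in>UNIV. (w$j - z$j) * g' j w) + (\<Sum>j\<in>UNIV. (w$j - z$j) * g j w)"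
      by (simp add: G_def distrib_left sum.distrib sum_distrib_left mult.left_commute)
    then show ?thesis
      using bspec[OF f(3) that] bspec[OF f'(3) that] by algebra
  qed
  ultimately have "z \<notin> supp K (ideal_prod A B)"
    unfolding notin_supp_iff[OF sub(3)] by (intro bexI[of _ "\<lambda>w. f w * f' w"] exI[of _ G]) auto
  with z show False by simp
qed

end

context regular_kernel
begin

text \<open>Evaluation at z shows that a representation of 1 needs some f with f(z) nonzero.
  Conversely, Gleason division applies to f(z) - f, and dividing by f(z) represents 1.\<close>

lemma supp_Int_bball:
  assumes cnp: "cnp K" and A: "mult_ideal K A"
  shows "supp K A \<inter> bball = zero_set A"
proof -
  have sub: "A \<subseteq> mult_alg K" using A by (simp add: mult_ideal_def)
  have "z \<notin> supp K A \<longleftrightarrow> (\<exists>f\<in>A. f z \<noteq> 0)" if z: "z \<in> bball" for z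
  proof
    assume "z \<notin> supp K A"
    then obtain f g where "f \<in> A" "\<forall>w\<in>bball. 1 = f w + (\<Sum>j\<in>UNIV. (w$j - z$j) * g j w)"
      unfolding notin_supp_iff[OF sub] by blast
    then have "f \<in> A" "1 = f z" using z by auto
    then show "\<exists>f\<in>A. f z \<noteq> 0" by (metis zero_neq_one)
  next
    assume "\<exists>f\<in>A. f z \<noteq> 0"
    then obtain f where f: "f \<in> A" "f z \<noteq> 0" by blast
    have "(\<lambda>w. bconst (f z) w + (-1) * f w) \<in> mult_alg K"
      using f sub by (intro mult_alg_add mult_alg_bconst mult_alg_scale) auto
    from gleason_division[OF cnp z this]
    obtain g where g: "\<And>j. g j \<in> mult_alg K"
      "\<And>w. w \<in> bball \<Longrightarrow> f z - f w = (\<Sum>j\<in>UNIV. (w$j - z$j) * g j w)"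
      using z by (auto simp: bconst_def)
    have "(\<lambda>w. bconst (1 / f z) w * f w) \<in> A"
      using A f mult_alg_bconst by (auto simp: mult_ideal_def)
    moreover have "(\<lambda>w. (1 / f z) * g j w) \<in> mult_alg K" for j
      by (intro mult_alg_scale g)
    moreover have "1 = bconst (1 / f z) w * f w + (\<Sum>j\<in>UNIV. (w$j - z$j) * ((1 / f z) * g j w))" if "w \<in> bball" for w
    proof -
      have "(\<Sum>j\<in>UNIV. (w$j - z$j) * ((1 / f z) * g j w)) = (1 / f z) * (f z - f w)"
        unfolding g(2)[OF that] sum_distrib_left by (intro sum.cong) auto
      then show ?thesis using f(2) that by (simp add: bconst_def field_simps)
    qed
    ultimately show "z \<notin> supp K A"
      unfolding notin_supp_iff[OF sub] by (intro bexI exI[of _ "\<lambda>j w. (1 / f z) * g j w"]) auto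
  qed
  then show ?thesis
    by (auto simp: zero_set_def)
qed

lemma supp_subset_cbball:
  assumes A: "mult_ideal K A"
  shows "supp K A \<subseteq> cbball"
proof
  fix z assume z: "z \<in> supp K A"
  have sub: "A \<subseteq> mult_alg K" "(\<lambda>w. 0) \<in> A" using A by (auto simp: mult_ideal_def)
  show "z \<in> cbball"
  proof (rule ccontr)
    assume "z \<notin> cbball"
    from division_outside[OF this] obtain g where "\<forall>j. g j \<in> mult_alg K"
      "\<forall>w\<in>bball. 1 = 0 + (\<Sum>j\<in>UNIV. (w$j - z$j) * g j w)"
      by auto
    then have "z \<notin> supp K A"
      unfolding notin_supp_iff[OF sub(1)] using sub(2) by (intro bexI[of _ "\<lambda>w. 0"] exI[of _ g]) auto
    with z show False by simp
  qed
qed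

end

theorem theorem3p4:
  fixes a :: "nat \<Rightarrow> real" and K :: "complex^'d \<Rightarrow> complex^'d \<Rightarrow> complex"
  assumes "regular_coeffs a" and "K = ukernel a" and "cnp K"
  shows "(\<forall>A. mult_ideal K A \<longrightarrow> supp K A \<inter> bball = zero_set A \<and> supp K A \<subseteq> cbball)
    \<and> (\<forall>A B. mult_ideal K A \<and> mult_ideal K B \<and> A \<subseteq> B \<longrightarrow> supp K B \<subseteq> supp K A)
    \<and> (\<forall>A B. mult_ideal K A \<and> mult_ideal K B \<longrightarrow>
          supp K (A \<inter> B) = supp K A \<union> supp K B
        \<and> supp K A \<union> supp K B = supp K (ideal_prod A B)
        \<and> supp K (ideal_sum A B) \<subseteq> supp K A \<inter> supp K B)
    \<and> (\<forall>A B. mult_ideal K A \<and> mult_ideal K B \<and> wstar_closed K A \<and> wstar_closed K B \<longrightarrow>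
          supp K (ideal_prod A B) = supp K (wstar_closure K (ideal_prod A B)))"
proof -
  interpret regular_kernel a K
    by unfold_locales (rule assms)+
  have prod: "supp K (A \<inter> B) = supp K A \<union> supp K B" "supp K A \<union> supp K B = supp K (ideal_prod A B)"
    if AB: "mult_ideal K A" "mult_ideal K B" for A B
  proof -
    \<comment> \<open>The inclusions close up into a circle, so all three sets coincide.\<close>
    have "supp K A \<union> supp K B \<subseteq> supp K (A \<inter> B)"
      using supp_antimono[of "A \<inter> B"] by blast
    moreover have "supp K (A \<inter> B) \<subseteq> supp K (ideal_prod A B)"
      using ideal_prod_subset[OF AB] by (rule supp_antimono)
    ultimately show "supp K (A \<inter> B) = supp K A \<union> supp K B" "supp K A \<union> supp K B = supp K (ideal_prod A B)"
      using supp_ideal_prod_subset[OF AB] by auto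
  qed
  have sum: "supp K (ideal_sum A B) \<subseteq> supp K A \<inter> supp K B" if AB: "mult_ideal K A" "mult_ideal K B" for A B
  proof -
    have "f \<in> ideal_sum A B" if "f \<in> A" for f
      unfolding ideal_sum_def using that AB
      by (intro CollectI exI[of _ f] exI[of _ "\<lambda>z. 0"]) (simp add: mult_ideal_def)
    moreover have "g \<in> ideal_sum A B" if "g \<in> B" for g
      unfolding ideal_sum_def using that AB
      by (intro CollectI exI[of _ "\<lambda>z. 0"] exI[of _ g]) (simp add: mult_ideal_def)
    ultimately have "A \<subseteq> ideal_sum A B" "B \<subseteq> ideal_sum A B"
      by blast+
    then show ?thesis
      by (simp add: supp_antimono)
  qed
  have closure: "supp K (ideal_prod A B) = supp K (wstar_closure K (ideal_prod A B))"
    if AB: "mult_ideal K A" "mult_ideal K B" and cl: "wstar_closed K A" "wstar_closed K B" for A B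
  proof
    \<comment> \<open>The closure is squeezed between the product and the intersection, whose
      supports are equal.\<close>
    have "wstar_closure K (ideal_prod A B) \<subseteq> A \<inter> B"
      using ideal_prod_subset[OF AB] cl wstar_closure_mono[of "ideal_prod A B" _ K]
      unfolding wstar_closed_def by blast
    then have "supp K (A \<inter> B) \<subseteq> supp K (wstar_closure K (ideal_prod A B))"
      by (rule supp_antimono)
    then show "supp K (ideal_prod A B) \<subseteq> supp K (wstar_closure K (ideal_prod A B))"
      using prod[OF AB] by simp
    have "ideal_prod A B \<subseteq> mult_alg K"
      using ideal_prod_subset[OF AB] AB by (auto simp: mult_ideal_def)
    then show "supp K (wstar_closure K (ideal_prod A B)) \<subseteq> supp K (ideal_prod A B)"
      by (intro supp_antimono subset_wstar_closure)
  qed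
  show ?thesis
  proof (intro conjI allI impI)
    show "supp K A \<inter> bball = zero_set A" "supp K A \<subseteq> cbball" if "mult_ideal K A" for A
      using supp_Int_bball[OF assms(3) that] supp_subset_cbball[OF that] by auto
    show "supp K B \<subseteq> supp K A" if "mult_ideal K A \<and> mult_ideal K B \<and> A \<subseteq> B" for A B
      using that by (intro supp_antimono) auto
    show "supp K (A \<inter> B) = supp K A \<union> supp K B" "supp K A \<union> supp K B = supp K (ideal_prod A B)"
      "supp K (ideal_sum A B) \<subseteq> supp K A \<inter> supp K B"
      if "mult_ideal K A \<and> mult_ideal K B" for A B
      using that prod[of A B] sum[of A B] by auto
    show "supp K (ideal_prod A B) = supp K (wstar_closure K (ideal_prod A B))"
      if "mult_ideal K A \<and> mult_ideal K B \<and> wstar_closed K A \<and> wstar_closed K B" for A B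
      using that by (intro closure) auto
  qed
qed

end
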